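(* Let $(\boldsymbol u_h;\boldsymbol v_h;\boldsymbol p_h)\in\boldsymbol U_h\times\boldsymbol V_h\times\boldsymbol P_h$ be the solution of the following discrete problem: for all $(\boldsymbol w_h;\boldsymbol z_h;\boldsymbol q_h)\in\boldsymbol U_h\times\boldsymbol V_h\times\boldsymbol P_h$, $$a_h(\boldsymbol u_h,\boldsymbol w_h)+\lambda(\operatorname{div}\boldsymbol u_h,\operatorname{div}\boldsymbol w_h)-\sum_{i=1}^n(p_{i,h},\operatorname{div}\boldsymbol w_h)=(\boldsymbol f,\boldsymbol w_h),$$ $$(R_i^{-1}\boldsymbol v_{i,h},\boldsymbol z_{i,h})-(p_{i,h},\operatorname{div}\boldsymbol z_{i,h})=0,\quad i=1,\dots,n,$$ $$-(\operatorname{div}\boldsymbol u_h,q_{i,h})-(\operatorname{div}\boldsymbol v_{i,h},q_{i,h})-(\alpha_{p_i}+\alpha_{ii})(p_{i,h},q_{i,h})+\sum_{j\ne i}\alpha_{ij}(p_{j,h},q_{i,h})=(g_i,q_{i,h}),\quad i=1,\dots,n.$$ Then $(\boldsymbol u_h;\boldsymbol v_h;\boldsymbol p_h)$ satisfies the pointwise mass conservation equation $$-\operatorname{div}\boldsymbol u_h-\operatorname{div}\boldsymbol v_{i,h}-(\alpha_{p_i}+\alpha_{ii})p_{i,h}+\sum_{j\ne i}\alpha_{ij}p_{j,h}=Q_{i,h}g_i,\quad i=1,\dots,n,\ \forall x\in K,\ \forall K\in\mathcal T_h,$$ where $Q_{i,h}$ denotes the $L^2$-projection onto $P_{i,h}$.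 Furthermore, if $g_i=0$, then $-\operatorname{div}\boldsymbol u_h-\operatorname{div}\boldsymbol v_{i,h}-(\alpha_{p_i}+\alpha_{ii})p_{i,h}+\sum_{j\ne i}\alpha_{ij}p_{j,h}=0$.
   Context: Domain and mesh: $\Omega\subset\mathbb R^d$, $d\in\{2,3\}$, is a bounded connected polygonal/polyhedral Lipschitz domain; $(\cdot,\cdot)$ is the $L^2(\Omega)$ inner product; $\boldsymbol f\in L^2(\Omega)^d$, $g_i\in L^2(\Omega)$. $\mathcal T_h$ is a shape-regular triangulation of $\Omega$ into simplices $K$; $\mathcal E_h$ is the set of all edges (faces if $d=3$), interior and boundary; $h_e$ is the diameter of $e$. $\boldsymbol\epsilon(\boldsymbol u)=\frac12(\nabla\boldsymbol u+(\nabla\boldsymbol u)^T)$ (elementwise). Traces: on an interior $e=\partial K_1\cap\partial K_2$ with exterior unit normals $\boldsymbol n_1,\boldsymbol n_2$, $\{\boldsymbol\tau\}=\frac12(\boldsymbol\tau|_{K_1}\boldsymbol n_1-\boldsymbol\tau|_{K_2}\boldsymbol n_2)$ for tensors and $[\boldsymbol v]=\boldsymbol v|_{K_1}-\boldsymbol v|_{K_2}$ for vectors; on a boundary $e$ with outward normal $\boldsymbol n$, $\{\boldsymbol\tau\}=\boldsymbol\tau\boldsymbol n$ and $[\boldsymbol v]=\boldsymbol v$. On $e$ with unit normal $\boldsymbol n$, $\boldsymbol u_t=\boldsymbol u-(\boldsymbol u\cdot\boldsymbol n)\boldsymbol n$. Finite element spaces: fix $l\ge1$. The local spaces $\boldsymbol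 U(K)/\boldsymbol V_i(K)/Q_i(K)$ are $BDM_l(K)/RT_{l-1}(K)/P_{l-1}(K)$ or $BDFM_l(K)/RT_{l-1}(K)/P_{l-1}(K)$ (Brezzi–Douglas–Marini, Brezzi–Douglas–Fortin–Marini, Raviart–Thomas elements, polynomials of degree $\le l-1$), so that $\operatorname{div}\boldsymbol U(K)=\operatorname{div}\boldsymbol V_i(K)=Q_i(K)$. For $i=1,\dots,n$: $\boldsymbol U_h=\{\boldsymbol u\in H(\operatorname{div};\Omega):\boldsymbol u|_K\in\boldsymbol U(K)\ \forall K,\ \boldsymbol u\cdot\boldsymbol n=0\text{ on }\partial\Omega\}$, $\boldsymbol V_{i,h}=\{\boldsymbol v\in H(\operatorname{div};\Omega):\boldsymbol v|_K\in\boldsymbol V_i(K)\ \forall K,\ \boldsymbol v\cdot\boldsymbol n=0\text{ on }\partial\Omega\}$, $P_{i,h}=\{q\in L^2(\Omega):q|_K\in Q_i(K)\ \forall K,\ \int_\Omega q\,dx=0\}$; $\boldsymbol V_h=\boldsymbol V_{1,h}\times\dots\times\boldsymbol V_{n,h}$, $\boldsymbol P_h=P_{1,h}\times\dots\times P_{n,h}$, with elements $\boldsymbol v_h=(\boldsymbol v_{1,h},\dots,\boldsymbol v_{n,h})$, $\boldsymbol p_h=(p_{1,h},\dots,p_{n,h})$. Parameters: $n\ge1$; constants $\lambda>0$; $R_i^{-1}>0$, $\alpha_{p_i}\ge0$; $\alpha_{ij}=\frac{\tau\beta_{ij}}{\alpha_i\alpha_j}\ge0$ ($i,j=1,\dots,n$)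 with $\tau>0$, $\alpha_i>0$, $\beta_{ij}=\beta_{ji}\ge0$ for $i\neq j$, $\beta_{ii}=\sum_{j\ne i}\beta_{ij}$. Form: $$a_h(\boldsymbol u,\boldsymbol w)=\sum_{K}\int_K\boldsymbol\epsilon(\boldsymbol u):\boldsymbol\epsilon(\boldsymbol w)\,dx-\sum_{e\in\mathcal E_h}\int_e\{\boldsymbol\epsilon(\boldsymbol u)\}\cdot[\boldsymbol w_t]\,ds-\sum_{e\in\mathcal E_h}\int_e\{\boldsymbol\epsilon(\boldsymbol w)\}\cdot[\boldsymbol u_t]\,ds+\sum_{e\in\mathcal E_h}\int_e\eta h_e^{-1}[\boldsymbol u_t]\cdot[\boldsymbol w_t]\,ds,$$ with $\eta$ a stabilization parameter. *)

theory Defs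
  imports "HOL-Analysis.Analysis"
begin

subsection \<open>Domain and mesh\<close>

text \<open>
  Near each boundary point, in suitable orthonormal coordinates with last axis \<open>\<nu>\<close>, the set is
  the region below the graph of a Lipschitz function of the remaining coordinates; the latter are
  represented by the orthogonal complement of \<open>\<nu>\<close>.
\<close>

definition lipschitz_domain :: "(real^'d) set \<Rightarrow> bool" where
  "lipschitz_domain \<Omega> \<longleftrightarrow>
     \<Omega> \<noteq> {} \<and> open \<Omega> \<and> connected \<Omega> \<and> bounded \<Omega> \<and>
     (\<forall>x0\<in>frontier \<Omega>. \<exists>\<nu> r L \<gamma>. norm \<nu> = 1 \<and> r > 0 \<and> L-lipschitz_on {z. z \<bullet> \<nu> = 0} \<gamma> \<and>
        (\<forall>y\<in>ball x0 r. y \<in> \<Omega> \<longleftrightarrow> y \<bullet> \<nu> < \<gamma> (y - (y \<bullet> \<nu>) *\<^sub>R \<nu>)))"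

definition polyhedral_lipschitz_domain :: "(real^'d) set \<Rightarrow> bool" where
  "polyhedral_lipschitz_domain \<Omega> \<longleftrightarrow>
     lipschitz_domain \<Omega> \<and> (\<exists>\<P>. finite \<P> \<and> (\<forall>P\<in>\<P>. polytope P) \<and> closure \<Omega> = \<Union>\<P>)"

definition mesh_of :: "(real^'d) set \<Rightarrow> (real^'d) set set \<Rightarrow> bool" where
  "mesh_of \<Omega> T \<longleftrightarrow> triangulation T \<and> (\<forall>K\<in>T. int CARD('d) simplex K) \<and> \<Union>T = closure \<Omega>"

definition shape_regular :: "real \<Rightarrow> (real^'d) set set \<Rightarrow> bool" where
  "shape_regular \<sigma> T \<longleftrightarrow> (\<forall>K\<in>T. diameter K \<le> \<sigma> * Sup {2 * r |r x. 0 \<le> r \<and> cball x r \<subseteq> K})"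

definition mesh_facets :: "(real^'d) set set \<Rightarrow> (real^'d) set set" where
  "mesh_facets T = {e. \<exists>K\<in>T. e facet_of K}"

definition interior_facet :: "(real^'d) set set \<Rightarrow> (real^'d) set \<Rightarrow> bool" where
  "interior_facet T e \<longleftrightarrow> (\<exists>K1\<in>T. \<exists>K2\<in>T. K1 \<noteq> K2 \<and> e facet_of K1 \<and> e facet_of K2)"

text \<open>
  The numbering of the two simplices at an interior facet is arbitrary.  Exchanging them changes
  the sign of both the jump and the average below, so the bilinear form does not depend on it.
\<close>

definition side1 :: "(real^'d) set set \<Rightarrow> (real^'d) set \<Rightarrow> (real^'d) set" where
  "side1 T e = (SOME K. K \<in> T \<and> e facet_of K)"

definition side2 :: "(real^'d) set set \<Rightarrow> (real^'d) set \<Rightarrow> (real^'d) set" where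
  "side2 T e = (SOME K. K \<in> T \<and> e facet_of K \<and> K \<noteq> side1 T e)"

definition outer_normal :: "(real^'d) set \<Rightarrow> (real^'d) set \<Rightarrow> real^'d" where
  "outer_normal K e = (THE \<nu>. norm \<nu> = 1 \<and> (\<forall>x\<in>K. \<forall>y\<in>e. \<nu> \<bullet> (x - y) \<le> 0))"

text \<open>
  Surface integral over a flat facet \<open>e\<close> with unit normal \<open>\<nu>\<close>: by Fubini it is the volume integral
  over the right cylinder of height one with base \<open>e\<close> of the function extended constantly in
  direction \<open>\<nu>\<close>.
\<close>

definition facet_integral :: "(real^'d) set \<Rightarrow> real^'d \<Rightarrow> (real^'d \<Rightarrow> real) \<Rightarrow> real" where
  "facet_integral e \<nu> f =
     (LINT y | lebesgue_on {x + t *\<^sub>R \<nu> |x t. x \<in> e \<and> t \<in> {0..1}}. f (closest_point (affine hull e) y))"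


subsection \<open>Function spaces\<close>

definition L2_on :: "(real^'d) set \<Rightarrow> (real^'d \<Rightarrow> 'b::euclidean_space) set" where
  "L2_on \<Omega> = {f. f \<in> borel_measurable (lebesgue_on \<Omega>) \<and>
                 integrable (lebesgue_on \<Omega>) (\<lambda>x. (norm (f x))\<^sup>2)}"

definition L2_inner :: "(real^'d) set \<Rightarrow> (real^'d \<Rightarrow> 'b::euclidean_space) \<Rightarrow> (real^'d \<Rightarrow> 'b) \<Rightarrow> real" where
  "L2_inner \<Omega> f g = (LINT x | lebesgue_on \<Omega>. f x \<bullet> g x)"

text \<open>
  Weak derivatives are tested with compactly supported functions of class \<open>C\<^sup>1\<close>; by mollification
  this gives the same notion as testing with smooth functions.  The predicate carries the gradient
  \<open>G\<close> of the test function \<open>\<zeta>\<close>.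
\<close>

definition test_function :: "(real^'d) set \<Rightarrow> (real^'d \<Rightarrow> real) \<Rightarrow> (real^'d \<Rightarrow> real^'d) \<Rightarrow> bool" where
  "test_function \<Omega> \<zeta> G \<longleftrightarrow>
     (\<forall>x. GDERIV \<zeta> x :> G x) \<and> continuous_on UNIV G \<and>
     compact (closure {x. \<zeta> x \<noteq> 0}) \<and> closure {x. \<zeta> x \<noteq> 0} \<subseteq> \<Omega>"

definition weak_divergence :: "(real^'d) set \<Rightarrow> (real^'d \<Rightarrow> real^'d) \<Rightarrow> (real^'d \<Rightarrow> real) \<Rightarrow> bool" where
  "weak_divergence \<Omega> u w \<longleftrightarrow>
     u \<in> L2_on \<Omega> \<and> w \<in> L2_on \<Omega> \<and>
     (\<forall>\<zeta> G. test_function \<Omega> \<zeta> G \<longrightarrow> L2_inner \<Omega> u G = - L2_inner \<Omega> w \<zeta>)"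

definition weak_gradient :: "(real^'d) set \<Rightarrow> (real^'d \<Rightarrow> real) \<Rightarrow> (real^'d \<Rightarrow> real^'d) \<Rightarrow> bool" where
  "weak_gradient \<Omega> \<phi> \<psi> \<longleftrightarrow>
     \<phi> \<in> L2_on \<Omega> \<and> \<psi> \<in> L2_on \<Omega> \<and>
     (\<forall>\<zeta> G. test_function \<Omega> \<zeta> G \<longrightarrow>
        (LINT x | lebesgue_on \<Omega>. \<phi> x *\<^sub>R G x) = - (LINT x | lebesgue_on \<Omega>. \<zeta> x *\<^sub>R \<psi> x))"

definition Hdiv :: "(real^'d) set \<Rightarrow> (real^'d \<Rightarrow> real^'d) set" where
  "Hdiv \<Omega> = {u. \<exists>w. weak_divergence \<Omega> u w}"

text \<open>
  The normal trace of a field in \<open>H(div)\<close> is the functional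
  \<open>\<langle>u \<bullet> n, \<phi>\<rangle> = (u, grad \<phi>) + (div u, \<phi>)\<close> on \<open>H\<^sup>1\<close>.
\<close>

definition zero_normal_trace :: "(real^'d) set \<Rightarrow> (real^'d \<Rightarrow> real^'d) \<Rightarrow> bool" where
  "zero_normal_trace \<Omega> u \<longleftrightarrow>
     (\<forall>w \<phi> \<psi>. weak_divergence \<Omega> u w \<longrightarrow> weak_gradient \<Omega> \<phi> \<psi> \<longrightarrow>
        L2_inner \<Omega> u \<psi> + L2_inner \<Omega> w \<phi> = 0)"


subsection \<open>Local and global finite element spaces\<close>

lemma finite_multiindices: "finite {\<alpha>::'d::finite \<Rightarrow> nat. sum \<alpha> UNIV \<le> k}"
proof (rule finite_subset)
  have "\<alpha> j \<le> k" if "sum \<alpha> UNIV \<le> k" for \<alpha> :: "'d \<Rightarrow> nat" and j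
  proof -
    have "\<alpha> j \<le> sum \<alpha> UNIV"
      by (rule member_le_sum) simp_all
    with that show ?thesis by linarith
  qed
  then show "{\<alpha>::'d \<Rightarrow> nat. sum \<alpha> UNIV \<le> k} \<subseteq> PiE UNIV (\<lambda>_. {..k})"
    by (simp add: PiE_UNIV_domain subset_eq Pi_iff)
  show "finite (PiE (UNIV :: 'd set) (\<lambda>_. {..k}))"
    by (rule finite_PiE) simp_all
qed

definition polys :: "nat \<Rightarrow> (real^'d \<Rightarrow> real) set" where
  "polys k = {p. \<exists>c. \<forall>x. p x = (\<Sum>\<alpha> | sum \<alpha> UNIV \<le> k. c \<alpha> * (\<Prod>j\<in>UNIV. (x $ j) ^ \<alpha> j))}"

definition vec_polys :: "nat \<Rightarrow> (real^'d \<Rightarrow> real^'d) set" where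
  "vec_polys k = {p. \<forall>j. (\<lambda>x. p x $ j) \<in> polys k}"

definition RT :: "nat \<Rightarrow> (real^'d \<Rightarrow> real^'d) set" where
  "RT k = {v. \<exists>a\<in>vec_polys k. \<exists>b\<in>polys k. \<forall>x. v x = a x + b x *\<^sub>R x}"

definition BDM :: "nat \<Rightarrow> (real^'d \<Rightarrow> real^'d) set" where
  "BDM l = vec_polys l"

definition BDFM :: "nat \<Rightarrow> (real^'d) set \<Rightarrow> (real^'d \<Rightarrow> real^'d) set" where
  "BDFM l K = {v \<in> vec_polys l. \<forall>e. e facet_of K \<longrightarrow>
                 (\<exists>p\<in>polys (l - 1). \<forall>x\<in>e. v x \<bullet> outer_normal K e = p x)}"

datatype displacement_family = BDM_family | BDFM_family

definition local_U :: "displacement_family \<Rightarrow> nat \<Rightarrow> (real^'d) set \<Rightarrow> (real^'d \<Rightarrow> real^'d) set" where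
  "local_U fam l K = (case fam of BDM_family \<Rightarrow> BDM l | BDFM_family \<Rightarrow> BDFM l K)"

text \<open>
  Discrete functions are representatives of \<open>L\<^sup>2\<close> classes, possibly discontinuous across facets; so
  the local condition is imposed on the interior of each closed simplex, and nothing is required
  of the values on the skeleton.
\<close>

definition U_h :: "(real^'d) set \<Rightarrow> (real^'d) set set \<Rightarrow> displacement_family \<Rightarrow> nat \<Rightarrow> (real^'d \<Rightarrow> real^'d) set" where
  "U_h \<Omega> T fam l = {u \<in> Hdiv \<Omega>. (\<forall>K\<in>T. \<exists>r\<in>local_U fam l K. \<forall>x\<in>interior K. u x = r x) \<and>
                       zero_normal_trace \<Omega> u}"

definition V_h :: "(real^'d) set \<Rightarrow> (real^'d) set set \<Rightarrow> nat \<Rightarrow> (real^'d \<Rightarrow> real^'d) set" where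
  "V_h \<Omega> T l = {v \<in> Hdiv \<Omega>. (\<forall>K\<in>T. \<exists>r\<in>RT (l - 1). \<forall>x\<in>interior K. v x = r x) \<and>
                   zero_normal_trace \<Omega> v}"

definition P_h :: "(real^'d) set \<Rightarrow> (real^'d) set set \<Rightarrow> nat \<Rightarrow> (real^'d \<Rightarrow> real) set" where
  "P_h \<Omega> T l = {q \<in> L2_on \<Omega>. (\<forall>K\<in>T. \<exists>r\<in>polys (l - 1). \<forall>x\<in>interior K. q x = r x) \<and>
                   (LINT x | lebesgue_on \<Omega>. q x) = 0}"

definition L2_projection ::
  "(real^'d) set \<Rightarrow> (real^'d \<Rightarrow> real) set \<Rightarrow> (real^'d \<Rightarrow> real) \<Rightarrow> real^'d \<Rightarrow> real" where
  "L2_projection \<Omega> P g = (SOME q. q \<in> P \<and> (\<forall>r\<in>P. L2_inner \<Omega> q r = L2_inner \<Omega> g r))"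


subsection \<open>Elementwise operators, traces and the bilinear form\<close>

text \<open>
  Classical derivatives, used in the interiors of the simplices only.  For a piecewise polynomial
  field in \<open>H(div)\<close>, \<open>divg\<close> agrees almost everywhere with the weak divergence.
\<close>

definition divg :: "(real^'d \<Rightarrow> real^'d) \<Rightarrow> real^'d \<Rightarrow> real" where
  "divg u x = trace (jacobian u (at x))"

definition sym_grad :: "(real^'d \<Rightarrow> real^'d) \<Rightarrow> real^'d \<Rightarrow> real^'d^'d" where
  "sym_grad u x = (1/2) *\<^sub>R (jacobian u (at x) + transpose (jacobian u (at x)))"

text \<open>
  \<open>restr K f\<close> is \<open>f|\<^sub>K\<close> on the closed simplex \<open>K\<close>: the continuous extension of \<open>f\<close> from the interior.
\<close>

definition restr :: "(real^'d) set \<Rightarrow> (real^'d \<Rightarrow> 'b::euclidean_space) \<Rightarrow> real^'d \<Rightarrow> 'b" where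
  "restr K f x = Lim (at x within interior K) f"

lemma restr_interior:
  assumes "x \<in> interior K" "isCont f x"
  shows "restr K f x = f x"
proof -
  have "at x within interior K = at x"
    by (rule at_within_open) (use assms in auto)
  then show ?thesis
    unfolding restr_def using assms(2) by (auto intro!: tendsto_Lim simp: isCont_def)
qed

definition jump ::
  "(real^'d) set set \<Rightarrow> (real^'d) set \<Rightarrow> (real^'d \<Rightarrow> real^'d) \<Rightarrow> real^'d \<Rightarrow> real^'d" where
  "jump T e v x =
     (if interior_facet T e then restr (side1 T e) v x - restr (side2 T e) v x
      else restr (side1 T e) v x)"

definition average ::
  "(real^'d) set set \<Rightarrow> (real^'d) set \<Rightarrow> (real^'d \<Rightarrow> real^'d^'d) \<Rightarrow> real^'d \<Rightarrow> real^'d" where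
  "average T e \<tau> x =
     (if interior_facet T e
      then (1/2) *\<^sub>R (restr (side1 T e) \<tau> x *v outer_normal (side1 T e) e
                     - restr (side2 T e) \<tau> x *v outer_normal (side2 T e) e)
      else restr (side1 T e) \<tau> x *v outer_normal (side1 T e) e)"

definition tangential :: "real^'d \<Rightarrow> (real^'d \<Rightarrow> real^'d) \<Rightarrow> real^'d \<Rightarrow> real^'d" where
  "tangential \<nu> u x = u x - (u x \<bullet> \<nu>) *\<^sub>R \<nu>"

text \<open>On \<open>real^'d^'d\<close> the inner product \<open>\<bullet>\<close> is the Frobenius product.\<close>

definition a_h ::
  "(real^'d) set set \<Rightarrow> real \<Rightarrow> (real^'d \<Rightarrow> real^'d) \<Rightarrow> (real^'d \<Rightarrow> real^'d) \<Rightarrow> real" where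
  "a_h T \<eta> u w =
     (\<Sum>K\<in>T. LINT x | lebesgue_on K. sym_grad u x \<bullet> sym_grad w x)
   - (\<Sum>e\<in>mesh_facets T. let \<nu> = outer_normal (side1 T e) e in
        facet_integral e \<nu> (\<lambda>x. average T e (sym_grad u) x \<bullet> jump T e (tangential \<nu> w) x))
   - (\<Sum>e\<in>mesh_facets T. let \<nu> = outer_normal (side1 T e) e in
        facet_integral e \<nu> (\<lambda>x. average T e (sym_grad w) x \<bullet> jump T e (tangential \<nu> u) x))
   + (\<Sum>e\<in>mesh_facets T. let \<nu> = outer_normal (side1 T e) e in
        facet_integral e \<nu> (\<lambda>x. \<eta> * inverse (diameter e) *
          (jump T e (tangential \<nu> u) x \<bullet> jump T e (tangential \<nu> w) x)))"

end

(*
  The third equation says that the residual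
  - div u - div v_i - (...) p_i + sum_j alpha_ij p_j and g_i have the same moments against P_{i,h}.
  The residual itself belongs to P_{i,h}: it is piecewise polynomial of degree l - 1, and it has mean
  value zero since the normal traces vanish.  Hence it is the L2-projection of g_i, almost
  everywhere and then, by continuity, everywhere on each closed simplex.
*)
theory Submission
  imports Defs
begin

subsection \<open>Polynomials\<close>

text \<open>The delicate point is the mean value. The trace condition speaks of the weak divergence,
  some square integrable function w, while the equations contain the classical \<open>divg\<close>,
  about which the skeleton says nothing. The two are compared without Green's formula on simplices
  and without facet traces: the test functions are supported in the union of the open simplices,
  where the field is C1, and they tend to one off a null set. Here membership in H(div) is decisive:
  since w is a function, the skeleton carries no mass of it, whereas a field with normal jumps would
  have a divergence concentrated on facets. The analytic input is that derivatives of compactly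
  supported C1 functions have integral zero. It gives constants the weak gradient zero, and it gives
  integration by parts. Moreover, \<open>L2_projection\<close> is a choice, so it has its defining
  property only if some element of \<open>P_h\<close> has the moments of g_i; the residual is such
  an element.\<close>

lemma polys_monomial:
  fixes \<alpha> :: "'d::finite \<Rightarrow> nat"
  assumes "sum \<alpha> UNIV \<le> k"
  shows "(\<lambda>x. \<Prod>j\<in>UNIV. (x $ j) ^ \<alpha> j) \<in> polys k"
proof -
  have "(\<Prod>j\<in>UNIV. (x $ j) ^ \<alpha> j) =
    (\<Sum>\<beta> | sum \<beta> UNIV \<le> k. (if \<beta> = \<alpha> then 1 else 0) * (\<Prod>j\<in>UNIV. (x $ j) ^ \<beta> j))" for x :: "real^'d"
    using assms finite_multiindices[where 'd='d, of k] by (simp add: if_distrib[of "\<lambda>c. c * _"] cong: if_cong)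
  then show ?thesis
    unfolding polys_def by (intro CollectI exI[of _ "\<lambda>\<beta>. if \<beta> = \<alpha> then 1 else 0"]) blast
qed

lemma polys_zero: "(\<lambda>x. 0) \<in> polys k"
  unfolding polys_def by (intro CollectI exI[of _ "\<lambda>\<beta>. 0"]) simp

lemma polys_add:
  assumes "p \<in> polys k" "q \<in> polys k"
  shows "(\<lambda>x. p x + q x) \<in> polys k"
proof -
  obtain c d where "\<forall>x. p x = (\<Sum>\<alpha> | sum \<alpha> UNIV \<le> k. c \<alpha> * (\<Prod>j\<in>UNIV. (x $ j) ^ \<alpha> j))"
    and "\<forall>x. q x = (\<Sum>\<alpha> | sum \<alpha> UNIV \<le> k. d \<alpha> * (\<Prod>j\<in>UNIV. (x $ j) ^ \<alpha> j))"
    using assms unfolding polys_def by blast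
  then show ?thesis
    unfolding polys_def
    by (intro CollectI exI[of _ "\<lambda>\<alpha>. c \<alpha> + d \<alpha>"]) (simp add: sum.distrib distrib_right)
qed

lemma polys_cmul:
  assumes "p \<in> polys k"
  shows "(\<lambda>x. a * p x) \<in> polys k"
proof -
  obtain c where "\<forall>x. p x = (\<Sum>\<alpha> | sum \<alpha> UNIV \<le> k. c \<alpha> * (\<Prod>j\<in>UNIV. (x $ j) ^ \<alpha> j))"
    using assms unfolding polys_def by blast
  then show ?thesis
    unfolding polys_def
    by (intro CollectI exI[of _ "\<lambda>\<alpha>. a * c \<alpha>"]) (simp add: sum_distrib_left mult.assoc)
qed

lemma polys_sum: "(\<And>i. i \<in> I \<Longrightarrow> p i \<in> polys k) \<Longrightarrow> (\<lambda>x. \<Sum>i\<in>I. p i x) \<in> polys k"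
  by (induction I rule: infinite_finite_induct) (auto intro: polys_zero polys_add)

lemma polys_continuous_on: "p \<in> polys k \<Longrightarrow> continuous_on S p"
  unfolding polys_def by (auto intro!: continuous_intros cong: continuous_on_cong)

lemma GDERIV_sum:
  "(\<And>i. i \<in> I \<Longrightarrow> GDERIV (f i) x :> D i) \<Longrightarrow> GDERIV (\<lambda>x. \<Sum>i\<in>I. f i x) x :> (\<Sum>i\<in>I. D i)"
  unfolding gderiv_def inner_sum_right by (rule has_derivative_sum)

text \<open>The operator x_j d/dx_j multiplies a monomial by its exponent and so preserves the
  degree. This bound is kept separately because it does not follow from the first one for k = 0,
  where k - 1 is again 0.\<close>

lemma monomial_gradient:
  fixes \<alpha> :: "'d::finite \<Rightarrow> nat"
  assumes "sum \<alpha> UNIV \<le> k"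
  defines "m \<equiv> \<lambda>x::real^'d. \<Prod>j\<in>UNIV. (x $ j) ^ \<alpha> j"
  obtains D where "\<And>j. D j \<in> polys (k - 1)" "\<And>j. (\<lambda>x. x $ j * D j x) \<in> polys k"
    "\<And>x. GDERIV m x :> (\<chi> j. D j x)"
proof -
  \<comment> \<open>For \<alpha> j = 0 the truncated exponent is harmless, since the factor in front
    vanishes.\<close>
  define D where "D j x = real (\<alpha> j) * (x $ j) ^ (\<alpha> j - 1) * (\<Prod>i\<in>UNIV - {j}. (x $ i) ^ \<alpha> i)"
    for j and x :: "real^'d"
  have "D j \<in> polys (k - 1)" for j
  proof (cases "\<alpha> j = 0")
    case True
    then have "D j = (\<lambda>x. 0)" by (auto simp: D_def)
    then show ?thesis by (simp add: polys_zero)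
  next
    case False
    define \<beta> where "\<beta> = \<alpha>(j := \<alpha> j - 1)"
    have "sum \<beta> UNIV = \<beta> j + sum \<beta> (UNIV - {j})" by (simp add: sum.remove)
    also have "\<dots> = \<alpha> j - 1 + sum \<alpha> (UNIV - {j})" by (simp add: \<beta>_def)
    also have "\<dots> = sum \<alpha> UNIV - 1" using False by (simp add: sum.remove[of UNIV j])
    finally have "sum \<beta> UNIV \<le> k - 1" using assms(1) by linarith
    moreover have "D j = (\<lambda>x. real (\<alpha> j) * (\<Prod>i\<in>UNIV. (x $ i) ^ \<beta> i))"
      by (auto simp: D_def \<beta>_def prod.remove[of UNIV j])
    ultimately show ?thesis by (auto intro: polys_cmul polys_monomial)
  qed
  moreover have "(\<lambda>x. x $ j * D j x) \<in> polys k" for j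
  proof -
    have "(\<lambda>x. x $ j * D j x) = (\<lambda>x. real (\<alpha> j) * m x)"
      by (cases "\<alpha> j") (auto simp: D_def m_def prod.remove[of UNIV j])
    then show ?thesis
      using assms by (auto intro: polys_cmul polys_monomial)
  qed
  moreover have "GDERIV m x :> (\<chi> j. D j x)" for x
    unfolding gderiv_def m_def inner_vec_def D_def
    by (rule has_derivative_eq_rhs[OF has_derivative_prod],
        rule has_derivative_power, rule bounded_linear.has_derivative[OF bounded_linear_vec_nth],
        rule has_derivative_ident) (auto simp: mult_ac intro!: sum.cong)
  ultimately show ?thesis by (rule that)
qed

lemma polys_gradient:
  fixes p :: "real^'d \<Rightarrow> real"
  assumes "p \<in> polys k"
  obtains D where "\<And>j. D j \<in> polys (k - 1)" "\<And>j. (\<lambda>x. x $ j * D j x) \<in> polys k"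
    "\<And>x. GDERIV p x :> (\<chi> j. D j x)"
proof -
  obtain c where p: "\<And>x. p x = (\<Sum>\<alpha> | sum \<alpha> UNIV \<le> k. c \<alpha> * (\<Prod>j\<in>UNIV. (x $ j) ^ \<alpha> j))"
    using assms unfolding polys_def by blast
  have "\<exists>D. (\<forall>j. D j \<in> polys (k - 1)) \<and> (\<forall>j. (\<lambda>x. x $ j * D j x) \<in> polys k) \<and>
      (\<forall>x::real^'d. GDERIV (\<lambda>x. \<Prod>j\<in>UNIV. (x $ j) ^ \<alpha> j) x :> (\<chi> j. D j x))"
    if "sum \<alpha> UNIV \<le> k" for \<alpha>
    by (rule monomial_gradient[OF that]) blast
  \<comment> \<open>The degree bound goes under the quantifier because \<open>choice\<close> asks
    for a witness at every multi-index.\<close>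
  then have "\<exists>D. \<forall>\<alpha>. sum \<alpha> UNIV \<le> k \<longrightarrow> (\<forall>j. D \<alpha> j \<in> polys (k - 1)) \<and>
      (\<forall>j. (\<lambda>x. x $ j * D \<alpha> j x) \<in> polys k) \<and>
      (\<forall>x::real^'d. GDERIV (\<lambda>x. \<Prod>j\<in>UNIV. (x $ j) ^ \<alpha> j) x :> (\<chi> j. D \<alpha> j x))"
    by (intro choice) blast
  then obtain D where D: "\<And>\<alpha> j. sum \<alpha> UNIV \<le> k \<Longrightarrow> D \<alpha> j \<in> polys (k - 1)"
    "\<And>\<alpha> j. sum \<alpha> UNIV \<le> k \<Longrightarrow> (\<lambda>x. x $ j * D \<alpha> j x) \<in> polys k"
    "\<And>\<alpha> x. sum \<alpha> UNIV \<le> k \<Longrightarrow>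
      GDERIV (\<lambda>x::real^'d. \<Prod>j\<in>UNIV. (x $ j) ^ \<alpha> j) x :> (\<chi> j. D \<alpha> j x)"
    by blast
  show ?thesis
  proof
    show "(\<lambda>x. \<Sum>\<alpha> | sum \<alpha> UNIV \<le> k. c \<alpha> * D \<alpha> j x) \<in> polys (k - 1)" for j
      using D(1) by (intro polys_sum polys_cmul) auto
    have "(\<lambda>x. \<Sum>\<alpha> | sum \<alpha> UNIV \<le> k. c \<alpha> * (x $ j * D \<alpha> j x)) \<in> polys k" for j
      using D(2) by (intro polys_sum polys_cmul) auto
    then show "(\<lambda>x. x $ j * (\<Sum>\<alpha> | sum \<alpha> UNIV \<le> k. c \<alpha> * D \<alpha> j x)) \<in> polys k" for j
      by (simp add: sum_distrib_left mult_ac)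
    have cD: "GDERIV (\<lambda>x. c \<alpha> * (\<Prod>j\<in>UNIV. (x $ j) ^ \<alpha> j)) x :> c \<alpha> *\<^sub>R (\<chi> j. D \<alpha> j x)"
      if "sum \<alpha> UNIV \<le> k" for \<alpha> x
      using GDERIV_mult[OF GDERIV_const D(3)[OF that]] by simp
    have "GDERIV p x :> (\<Sum>\<alpha> | sum \<alpha> UNIV \<le> k. c \<alpha> *\<^sub>R (\<chi> j. D \<alpha> j x))" for x
      unfolding p[abs_def] by (rule GDERIV_sum) (use cD in auto)
    moreover have "(\<Sum>\<alpha> | sum \<alpha> UNIV \<le> k. c \<alpha> *\<^sub>R (\<chi> j. D \<alpha> j x)) =
        (\<chi> j. \<Sum>\<alpha> | sum \<alpha> UNIV \<le> k. c \<alpha> * D \<alpha> j x)" for x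
      by (simp add: vec_eq_iff)
    ultimately show "GDERIV p x :> (\<chi> j. \<Sum>\<alpha> | sum \<alpha> UNIV \<le> k. c \<alpha> * D \<alpha> j x)" for x
      by simp
  qed
qed

lemma polys_mono:
  assumes "p \<in> polys k" "k \<le> m"
  shows "p \<in> polys m"
proof -
  obtain c where p: "\<And>x. p x = (\<Sum>\<alpha> | sum \<alpha> UNIV \<le> k. c \<alpha> * (\<Prod>j\<in>UNIV. (x $ j) ^ \<alpha> j))"
    using assms unfolding polys_def by blast
  have "(\<lambda>x. \<Sum>\<alpha> | sum \<alpha> UNIV \<le> k. c \<alpha> * (\<Prod>j\<in>UNIV. (x $ j) ^ \<alpha> j)) \<in> polys m"
    by (intro polys_sum polys_cmul polys_monomial) (use \<open>k \<le> m\<close> in auto)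
  with p show ?thesis by presburger
qed

section \<open>Gradients of components, Jacobian and divergence\<close>

lemma GDERIV_component_has_derivative:
  fixes u :: "real^'d \<Rightarrow> real^'d"
  assumes "\<And>j. GDERIV (\<lambda>y. u y $ j) x :> D j"
  shows "(u has_derivative (\<lambda>h. \<chi> j. h \<bullet> D j)) (at x)"
  using assms unfolding gderiv_def
  by (subst has_derivative_componentwise_within)
     (auto simp: Basis_vec_def inner_axis)

text \<open>\<open>jacobian\<close> rests on the choice made in \<open>frechet_derivative\<close>;
  uniqueness of the derivative makes its rows computable.\<close>

lemma jacobian_GDERIV:
  fixes u :: "real^'d \<Rightarrow> real^'d"
  assumes "\<And>j. GDERIV (\<lambda>y. u y $ j) x :> D j"
  shows "jacobian u (at x) $ j = D j"
proof -
  have "frechet_derivative u (at x) = (\<lambda>h. \<chi> j. h \<bullet> D j)"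
    using frechet_derivative_at[OF GDERIV_component_has_derivative[OF assms]] by simp
  then show ?thesis
    by (simp add: jacobian_def matrix_def inner_axis' vec_eq_iff)
qed

lemma divg_GDERIV:
  assumes "\<And>j. GDERIV (\<lambda>y. u y $ j) x :> D j"
  shows "divg u x = (\<Sum>j\<in>UNIV. D j $ j)"
  by (simp add: divg_def trace_def jacobian_GDERIV[OF assms])

text \<open>What the BDM, BDFM and RT fields have in common. The index is the degree of the
  divergence, not of the field; of the single derivatives only continuity is kept, as integration by
  parts asks for it.\<close>

definition C1_polys_div :: "nat \<Rightarrow> (real^'d \<Rightarrow> real^'d) \<Rightarrow> bool" where
  "C1_polys_div k r \<longleftrightarrow> (\<exists>D. (\<forall>j x. GDERIV (\<lambda>y. r y $ j) x :> D j x) \<and>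
     (\<forall>j. continuous_on UNIV (D j)) \<and> (\<lambda>x. \<Sum>j\<in>UNIV. D j x $ j) \<in> polys k)"

lemma continuous_on_polys_vec:
  "(\<And>j. D j \<in> polys k) \<Longrightarrow> continuous_on S (\<lambda>x. \<chi> j. D j x)"
  by (intro continuous_on_vec_lambda polys_continuous_on) 

lemma C1_polys_div_vec_polys:
  assumes "r \<in> vec_polys k"
  shows "C1_polys_div (k - 1) r"
proof -
  have "\<exists>D. (\<forall>i. D i \<in> polys (k - 1)) \<and> (\<forall>x. GDERIV (\<lambda>y. r y $ j) x :> (\<chi> i. D i x))" for j
  proof -
    have "(\<lambda>x. r x $ j) \<in> polys k" using assms by (simp add: vec_polys_def)
    then show ?thesis by (rule polys_gradient) blast
  qed
  then have "\<exists>D. \<forall>j. (\<forall>i. D j i \<in> polys (k - 1)) \<and> (\<forall>x. GDERIV (\<lambda>y. r y $ j) x :> (\<chi> i. D j i x))"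
    by (intro choice) blast
  then obtain D where "\<And>i j. D j i \<in> polys (k - 1)"
    "\<And>j x. GDERIV (\<lambda>y. r y $ j) x :> (\<chi> i. D j i x)"
    by blast
  then show ?thesis
    unfolding C1_polys_div_def
    by (intro exI[of _ "\<lambda>j x. \<chi> i. D j i x"])
       (auto intro!: continuous_on_polys_vec polys_sum)
qed

text \<open>Since \<open>div (b x) = d b + x \<bullet> grad b\<close> and \<open>x\<^sub>j \<partial>\<^sub>j\<close> preserves degrees, the extra
  degree of the Raviart-Thomas fields is not seen by the divergence.\<close>

lemma C1_polys_div_RT:
  fixes r :: "real^'d \<Rightarrow> real^'d"
  assumes "r \<in> RT k"
  shows "C1_polys_div k r"
proof -
  obtain a b where a: "a \<in> vec_polys k" and b: "b \<in> polys k" and r: "\<And>x. r x = a x + b x *\<^sub>R x"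
    using assms unfolding RT_def by auto
  obtain A where A: "\<And>j x. GDERIV (\<lambda>y. a y $ j) x :> A j x" "\<And>j. continuous_on UNIV (A j)"
      and Ap: "(\<lambda>x. \<Sum>j\<in>UNIV. A j x $ j) \<in> polys (k - 1)"
    using C1_polys_div_vec_polys[OF a] unfolding C1_polys_div_def by blast
  obtain B where B: "\<And>j. B j \<in> polys (k - 1)" "\<And>j. (\<lambda>x. x $ j * B j x) \<in> polys k"
    "\<And>x. GDERIV b x :> (\<chi> j. B j x)"
    using polys_gradient[OF b] by blast
  define D where "D j x = A j x + (b x *\<^sub>R axis j 1 + (x $ j) *\<^sub>R (\<chi> i. B i x))" for j and x :: "real^'d"
  have coord: "GDERIV (\<lambda>y. y $ j) x :> axis j 1" for j and x :: "real^'d"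
    unfolding gderiv_def inner_axis
    by (simp add: bounded_linear_imp_has_derivative bounded_linear_vec_nth)
  have "GDERIV (\<lambda>y. r y $ j) x :> D j x" for j x
    using GDERIV_add[OF A(1)[of j x] GDERIV_mult[OF B(3)[of x] coord[of j x]]]
    by (simp add: r D_def)
  moreover have "continuous_on UNIV (D j)" for j
    unfolding D_def using A(2) B(1) b
    by (intro continuous_intros continuous_on_polys_vec polys_continuous_on; assumption?) auto
  moreover have "(\<lambda>x. \<Sum>j\<in>UNIV. D j x $ j) \<in> polys k"
  proof -
    have "(\<lambda>x. (\<Sum>j\<in>UNIV. A j x $ j) + (real CARD('d) * b x + (\<Sum>j\<in>UNIV. x $ j * B j x))) \<in> polys k"
      by (intro polys_add polys_cmul polys_sum B b polys_mono[OF Ap]) auto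
    then show ?thesis by (simp add: D_def sum.distrib)
  qed
  ultimately show ?thesis unfolding C1_polys_div_def by blast
qed

text \<open>A BDFM field is a polynomial field with restricted normal components on the facets; the
  containing space already decides about the divergence.\<close>

lemma C1_polys_div_local_U: "r \<in> local_U fam l K \<Longrightarrow> C1_polys_div (l - 1) r"
  by (rule C1_polys_div_vec_polys) (auto simp: local_U_def BDM_def BDFM_def split: displacement_family.splits)


subsection \<open>Integration by parts and cut-off functions\<close>

lemma integral_lborel_translation:
  fixes h :: "'a::euclidean_space \<Rightarrow> real"
  assumes "h \<in> borel_measurable borel"
  shows "(LINT x|lborel. h (a + x)) = (LINT x|lborel. h x)"
proof -
  have "(LINT x|lborel. h x) = (LINT x|distr lborel borel ((+) a). h x)"
    by (simp add: lborel_distr_plus)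
  also have "\<dots> = (LINT x|lborel. h (a + x))"
    by (rule integral_distr) (use assms in auto)
  finally show ?thesis by simp
qed

lemma integrable_compact_support:
  fixes h :: "'a::euclidean_space \<Rightarrow> real"
  assumes "continuous_on UNIV h" "compact S" "\<And>x. x \<notin> S \<Longrightarrow> h x = 0"
  shows "integrable lborel h"
proof -
  have "integrable lborel (\<lambda>x. indicator S x *\<^sub>R h x)"
    using assms borel_integrable_compact[of S h] continuous_on_subset by fastforce
  moreover have "(\<lambda>x. indicator S x *\<^sub>R h x) = h"
    using assms(3) by (auto simp: indicator_def fun_eq_iff)
  ultimately show ?thesis by simp
qed

lemma gradient_eq_0_outside_support:
  fixes h :: "'a::real_inner \<Rightarrow> real"
  assumes "GDERIV h x :> D" "closed S" "x \<notin> S" "\<And>y. y \<notin> S \<Longrightarrow> h y = 0"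
  shows "D = 0"
proof -
  have "(h has_derivative (\<lambda>v. 0)) (at x)"
    by (rule has_derivative_transform_within_open[of "\<lambda>x. 0" _ _ UNIV "- S"])
       (use assms in \<open>auto simp: open_Compl\<close>)
  with assms(1) have "(\<lambda>v. v \<bullet> D) = (\<lambda>v. 0)"
    unfolding gderiv_def by (rule has_derivative_unique)
  then show ?thesis by (metis inner_eq_zero_iff)
qed

text \<open>By translation invariance the difference quotients of \<open>h\<close> have integral zero; they
  converge boundedly to the directional derivative.\<close>

lemma integral_directional_derivative_eq_0:
  fixes h :: "'a::euclidean_space \<Rightarrow> real"
  assumes h: "\<And>x. GDERIV h x :> D x" and D: "continuous_on UNIV D"
    and S: "compact S" "\<And>x. x \<notin> S \<Longrightarrow> h x = 0"
  shows "(LINT x|lborel. a \<bullet> D x) = 0"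
proof -
  have D0: "D x = 0" if "x \<notin> S" for x
    using gradient_eq_0_outside_support[OF h compact_imp_closed[OF S(1)] that] S(2) by blast
  have contD: "continuous_on UNIV (\<lambda>x. a \<bullet> D x)"
    using D by (intro continuous_intros)
  obtain M where "\<forall>y\<in>(\<lambda>x. a \<bullet> D x) ` S. norm y \<le> M"
    using compact_imp_bounded[OF compact_continuous_image[OF continuous_on_subset[OF contD] S(1)]]
    unfolding bounded_iff by blast
  \<comment> \<open>The 0 takes care of the points off \<open>S\<close>, where the gradient
    vanishes.\<close>
  then have M: "\<bar>a \<bullet> D x\<bar> \<le> max M 0" for x
    using D0[of x] by (cases "x \<in> S") fastforce+
  have "isCont h x" for x using h[of x] unfolding gderiv_def by (rule has_derivative_continuous)
  then have cont: "continuous_on UNIV h" by (simp add: continuous_at_imp_continuous_on)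
  have int: "integrable lborel h" by (rule integrable_compact_support[OF cont S])
  \<comment> \<open>Steps of length at most 1 keep all translated supports inside the one compact
    set \<open>S'\<close> below, which carries the dominating function.\<close>
  define t :: "nat \<Rightarrow> real" where "t n = 1 / real (Suc n)" for n
  have t: "0 < t n" "t n \<le> 1" for n by (auto simp: t_def)
  have t0: "t \<longlonglongrightarrow> 0"
    unfolding t_def using LIMSEQ_inverse_real_of_nat by (simp add: inverse_eq_divide)
  define q where "q n x = (h (t n *\<^sub>R a + x) - h x) / t n" for n x
  have line: "((\<lambda>s. h (s *\<^sub>R a + x)) has_real_derivative a \<bullet> D (s *\<^sub>R a + x)) (at s)" for x s
  proof -
    have "((\<lambda>s. h (s *\<^sub>R a + x)) has_derivative (\<lambda>v. (v *\<^sub>R a) \<bullet> D (s *\<^sub>R a + x))) (at s)"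
      using h[unfolded gderiv_def, of "s *\<^sub>R a + x"]
      by (rule has_derivative_compose[rotated]) (auto intro!: derivative_eq_intros)
    then show ?thesis by (simp add: has_field_derivative_def mult.commute[of _ "a \<bullet> _"])
  qed
  have borel[measurable]: "h \<in> borel_measurable borel"
    using cont by (rule borel_measurable_continuous_onI)
  have borelD[measurable]: "(\<lambda>x. a \<bullet> D x) \<in> borel_measurable borel"
    using contD by (rule borel_measurable_continuous_onI)
  define S' where "S' = (\<lambda>(s, y). y - s *\<^sub>R a) ` ({0..1} \<times> S)"
  have S': "compact S'"
    unfolding S'_def
    by (intro compact_continuous_image compact_Times S)
       (auto simp: case_prod_unfold intro!: continuous_intros)
  have bound: "\<bar>q n x\<bar> \<le> max M 0 * indicator S' x" for n x
  proof -
    \<comment> \<open>By the mean value theorem the quotient is a value of the directional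
      derivative, hence bounded; if that value is nonzero, it is taken at a point of
      \<open>S\<close>, which puts x into \<open>S'\<close>.\<close>
    have "\<exists>s>0. s < t n \<and>
        h (t n *\<^sub>R a + x) - h (0 *\<^sub>R a + x) = (t n - 0) * (a \<bullet> D (s *\<^sub>R a + x))"
      by (rule MVT2[OF t(1)[of n] line])
    then obtain s where s: "0 < s" "s < t n"
        "h (t n *\<^sub>R a + x) - h (0 *\<^sub>R a + x) = (t n - 0) * (a \<bullet> D (s *\<^sub>R a + x))"
      by (elim exE conjE)
    then have q: "q n x = a \<bullet> D (s *\<^sub>R a + x)" using t(1)[of n] by (simp add: q_def)
    show ?thesis
    proof (cases "s *\<^sub>R a + x \<in> S")
      case True
      then have "x \<in> S'"
        unfolding S'_def using s t(2)[of n] by (intro image_eqI[of _ _ "(s, s *\<^sub>R a + x)"]) auto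
      then show ?thesis using q M by simp
    qed (simp add: q D0)
  qed
  have "(\<lambda>n. LINT x|lborel. q n x) \<longlonglongrightarrow> (LINT x|lborel. a \<bullet> D x)"
  proof (rule integral_dominated_convergence[where w = "\<lambda>x. max M 0 * indicator S' x"])
    show "q n \<in> borel_measurable lborel" for n unfolding q_def by simp
    show "integrable lborel (\<lambda>x. max M 0 * indicator S' x)"
      using S' by (intro integrable_mult_right integrable_real_indicator)
        (auto simp: borel_compact emeasure_compact_finite[unfolded infinity_ennreal_def])
    show "AE x in lborel. (\<lambda>n. q n x) \<longlonglongrightarrow> a \<bullet> D x"
    proof (rule AE_I2)
      fix x
      have "((\<lambda>s. (h ((0 + s) *\<^sub>R a + x) - h (0 *\<^sub>R a + x)) / s) \<longlongrightarrow> a \<bullet> D (0 *\<^sub>R a + x)) (at 0)"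
        using line[of x 0] by (simp add: DERIV_def)
      then have "((\<lambda>s. (h (s *\<^sub>R a + x) - h x) / s) \<longlongrightarrow> a \<bullet> D x) (at 0)" by simp
      moreover have "filterlim t (at 0) sequentially"
        using t0 t(1) by (auto simp: filterlim_at intro!: always_eventually less_imp_neq[symmetric])
      ultimately show "(\<lambda>n. q n x) \<longlonglongrightarrow> a \<bullet> D x"
        unfolding q_def by (rule filterlim_compose)
    qed
    show "AE x in lborel. norm (q n x) \<le> max M 0 * indicator S' x" for n
      using bound by simp
  qed simp
  moreover have "(LINT x|lborel. q n x) = 0" for n
  proof -
    have "integrable lborel (\<lambda>x. h (t n *\<^sub>R a + x))"
    proof (rule integrable_compact_support)
      show "continuous_on UNIV (\<lambda>x. h (t n *\<^sub>R a + x))"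
        by (intro continuous_on_compose2[OF cont] continuous_intros) auto
      show "compact ((\<lambda>y. y - t n *\<^sub>R a) ` S)"
        by (intro compact_continuous_image S continuous_intros)
      show "h (t n *\<^sub>R a + x) = 0" if "x \<notin> (\<lambda>y. y - t n *\<^sub>R a) ` S" for x
        using that by (intro S(2)) (metis add_diff_cancel_left' image_eqI)
    qed
    then show ?thesis
      using int integral_lborel_translation[OF borel, of "t n *\<^sub>R a"]
      by (simp add: q_def)
  qed
  ultimately show ?thesis by (simp add: LIMSEQ_const_iff)
qed

section \<open>Test functions, bumps and the exhaustion of open sets\<close>

lemma test_function_continuous:
  assumes "test_function W \<zeta> G"
  shows "continuous_on S \<zeta>" "continuous_on S G"
proof -
  have "(\<zeta> has_derivative (\<lambda>h. h \<bullet> G x)) (at x within S)" for x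
    using assms has_derivative_at_withinI unfolding test_function_def gderiv_def by blast
  then show "continuous_on S \<zeta>" by (rule has_derivative_continuous_on)
  show "continuous_on S G"
    using assms continuous_on_subset unfolding test_function_def by blast
qed

lemma test_function_support:
  assumes "test_function W \<zeta> G"
  defines "S \<equiv> closure {x. \<zeta> x \<noteq> 0}"
  shows "compact S" "S \<subseteq> W" "\<And>x. x \<notin> S \<Longrightarrow> \<zeta> x = 0" "\<And>x. x \<notin> S \<Longrightarrow> G x = 0"
proof -
  show "compact S" "S \<subseteq> W" using assms(1) by (auto simp: S_def test_function_def)
  show z: "\<zeta> x = 0" if "x \<notin> S" for x
  proof (rule ccontr)
    assume "\<zeta> x \<noteq> 0"
    then have "x \<in> S" unfolding S_def by (intro subsetD[OF closure_subset]) simp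
    with that show False ..
  qed
  show "G x = 0" if "x \<notin> S" for x
  proof (rule gradient_eq_0_outside_support[OF _ _ that])
    show "GDERIV \<zeta> x :> G x" using assms(1) by (simp add: test_function_def)
  qed (simp add: S_def, rule z)
qed

text \<open>The closure of the nonzero set is awkward to compute; any compact set off which the
  function vanishes contains it.\<close>

lemma test_functionI:
  assumes "\<And>x. GDERIV \<zeta> x :> G x" "continuous_on UNIV G"
    and "compact S" "S \<subseteq> W" "\<And>x. x \<notin> S \<Longrightarrow> \<zeta> x = 0"
  shows "test_function W \<zeta> G"
proof -
  have "closure {x. \<zeta> x \<noteq> 0} \<subseteq> S"
    using assms by (intro closure_minimal compact_imp_closed) auto
  moreover have "compact (closure {x. \<zeta> x \<noteq> 0})"
    using compact_Int_closed[OF \<open>compact S\<close>, of "closure {x. \<zeta> x \<noteq> 0}"] calculation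
    by (simp add: inf.absorb2)
  ultimately show ?thesis using assms unfolding test_function_def by blast
qed

lemma test_function_mono: "test_function W \<zeta> G \<Longrightarrow> W \<subseteq> W' \<Longrightarrow> test_function W' \<zeta> G"
  unfolding test_function_def by blast

text \<open>The function a + b - a b: it has values in [0, 1] if a and b do, is then positive
  wherever one of them is, and unlike a maximum it stays C1.\<close>

lemma test_function_prob_sum:
  assumes a: "test_function W a A" and b: "test_function W b B"
  shows "test_function W (\<lambda>x. 1 - (1 - a x) * (1 - b x))
    (\<lambda>x. (1 - a x) *\<^sub>R B x + (1 - b x) *\<^sub>R A x)"
proof -
  let ?S = "closure {x. a x \<noteq> 0}" and ?S' = "closure {x. b x \<noteq> 0}"
  show ?thesis
  proof (rule test_functionI[of _ _ "?S \<union> ?S'"])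
    fix x
    have "GDERIV (\<lambda>x. 1 - (1 - a x) * (1 - b x)) x :>
        0 - ((1 - a x) *\<^sub>R (0 - B x) + (1 - b x) *\<^sub>R (0 - A x))"
      using a b unfolding test_function_def
      by (intro GDERIV_diff GDERIV_mult GDERIV_const) auto
    then show "GDERIV (\<lambda>x. 1 - (1 - a x) * (1 - b x)) x :>
        (1 - a x) *\<^sub>R B x + (1 - b x) *\<^sub>R A x" by (simp add: add.commute)
  next
    show "continuous_on UNIV (\<lambda>x. (1 - a x) *\<^sub>R B x + (1 - b x) *\<^sub>R A x)"
      by (intro continuous_intros test_function_continuous[OF a] test_function_continuous[OF b])
  next
    show "compact (?S \<union> ?S')"
      by (rule compact_Un[OF test_function_support(1)[OF a] test_function_support(1)[OF b]])
    show "?S \<union> ?S' \<subseteq> W"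
      by (rule Un_least[OF test_function_support(2)[OF a] test_function_support(2)[OF b]])
    show "1 - (1 - a x) * (1 - b x) = 0" if "x \<notin> ?S \<union> ?S'" for x
    proof -
      have "a x = 0" "b x = 0"
        using that by (auto intro: test_function_support(3)[OF a] test_function_support(3)[OF b])
      then show ?thesis by simp
    qed
  qed
qed


lemma test_function_zero: "test_function W (\<lambda>x. 0) (\<lambda>x. 0)"
  by (simp add: test_function_def gderiv_def)

text \<open>Used twice in the exhaustion of an open set: for copies of one bump, which yields
  powers, and then across different bumps.\<close>

lemma test_function_prod:
  fixes N :: nat
  assumes "\<And>k. k < N \<Longrightarrow> \<exists>G. test_function W (b k) G"
  shows "\<exists>G. test_function W (\<lambda>x. 1 - (\<Prod>k<N. 1 - b k x)) G"
  using assms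
proof (induction N)
  case 0
  show ?case using test_function_zero[of W] by (intro exI) simp
next
  case (Suc N)
  have "\<exists>A. test_function W (\<lambda>x. 1 - (\<Prod>k<N. 1 - b k x)) A"
    by (rule Suc.IH) (rule Suc.prems, simp)
  then obtain A where A: "test_function W (\<lambda>x. 1 - (\<Prod>k<N. 1 - b k x)) A" by blast
  obtain B where B: "test_function W (b N) B" using Suc.prems[of N] by blast
  show ?case using test_function_prob_sum[OF A B] by (intro exI) simp
qed

text \<open>Squaring removes the kink: the difference quotient at 0 is the positive part itself,
  which tends to 0. So C1 bumps can be written down without exponentials.\<close>

lemma DERIV_max_0_square: "((\<lambda>t::real. (max 0 t)\<^sup>2) has_real_derivative 2 * max 0 t) (at t)"
proof -
  consider "t > 0" | "t < 0" | "t = 0" by linarith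
  then show ?thesis
  proof cases
    case 1
    have "((\<lambda>t. t\<^sup>2) has_real_derivative 2 * t) (at t)" by (auto intro!: derivative_eq_intros)
    then have "((\<lambda>t. (max 0 t)\<^sup>2) has_real_derivative 2 * t) (at t)"
      by (rule has_field_derivative_transform_within_open[of _ _ _ "{0<..}"]) (use 1 in auto)
    with 1 show ?thesis by simp
  next
    case 2
    have "((\<lambda>t. 0) has_real_derivative 0) (at t)" by simp
    then have "((\<lambda>t. (max 0 t)\<^sup>2) has_real_derivative 0) (at t)"
      by (rule has_field_derivative_transform_within_open[of _ _ _ "{..<0}"]) (use 2 in auto)
    with 2 show ?thesis by simp
  next
    case 3
    have "((\<lambda>h::real. max 0 h) \<longlongrightarrow> max 0 0) (at 0)" by (intro tendsto_intros)
    moreover have "(max 0 h)\<^sup>2 / h = max 0 h" for h :: real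
      by (auto simp: max_def power2_eq_square)
    ultimately show ?thesis using 3 by (simp add: DERIV_def)
  qed
qed

text \<open>The squared distance is differentiable at the centre too. The bump is positive exactly
  on the open ball and its support lies in the closed one, which therefore has to fit into
  \<open>W\<close>.\<close>

lemma test_function_bump:
  fixes c :: "real^'d"
  assumes r: "r > 0" "cball c r \<subseteq> W"
  defines "b \<equiv> \<lambda>x. (max 0 (1 - ((x - c) \<bullet> (x - c)) / r\<^sup>2))\<^sup>2"
  shows "\<exists>G. test_function W b G" "\<And>x. 0 \<le> b x" "\<And>x. b x \<le> 1"
proof -
  define s where "s x = 1 - ((x - c) \<bullet> (x - c)) / r\<^sup>2" for x
  have b: "b x = (max 0 (s x))\<^sup>2" for x by (simp add: b_def s_def)
  have s: "s x > 0 \<longleftrightarrow> dist c x < r" for x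
  proof -
    have "s x > 0 \<longleftrightarrow> (dist c x)\<^sup>2 < r\<^sup>2"
      using r by (simp add: s_def divide_less_eq dist_norm norm_minus_commute[of c x] power2_norm_eq_inner)
    also have "\<dots> \<longleftrightarrow> dist c x < r"
      using r power_less_imp_less_base[of "dist c x" 2 r] power_strict_mono[of "dist c x" r 2] by auto
    finally show ?thesis .
  qed
  show "0 \<le> b x" for x by (simp add: b)
  have "s x \<le> 1" for x by (simp add: s_def)
  then show "b x \<le> 1" for x by (simp add: b power_le_one)
  have G: "GDERIV b x :> (2 * max 0 (s x)) *\<^sub>R ((- 2 / r\<^sup>2) *\<^sub>R (x - c))" for x
  proof -
    have "GDERIV s x :> (- 2 / r\<^sup>2) *\<^sub>R (x - c)"
    proof -
      have d: "((\<lambda>y. y - c) has_derivative (\<lambda>v. v)) (at x)"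
        by (auto intro!: derivative_eq_intros)
      have "(s has_derivative (\<lambda>v. 0 - ((x - c) \<bullet> v + v \<bullet> (x - c)) / r\<^sup>2)) (at x)"
        unfolding s_def[abs_def]
        by (rule has_derivative_diff[OF has_derivative_const
              bounded_linear.has_derivative[OF bounded_linear_divide has_derivative_inner[OF d d]]])
      moreover have "(\<lambda>v. 0 - ((x - c) \<bullet> v + v \<bullet> (x - c)) / r\<^sup>2) = (\<lambda>v. v \<bullet> ((- 2 / r\<^sup>2) *\<^sub>R (x - c)))"
        by (simp add: inner_commute[of "x - c"])
      ultimately show ?thesis by (simp add: gderiv_def)
    qed
    from GDERIV_DERIV_compose[OF this DERIV_max_0_square] show ?thesis
      unfolding b[abs_def] .
  qed
  have "test_function W b (\<lambda>x. (2 * max 0 (s x)) *\<^sub>R ((- 2 / r\<^sup>2) *\<^sub>R (x - c)))"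
  proof (rule test_functionI[OF G])
    show "continuous_on UNIV (\<lambda>x. (2 * max 0 (s x)) *\<^sub>R ((- 2 / r\<^sup>2) *\<^sub>R (x - c)))"
      unfolding s_def using r by (intro continuous_intros) auto
    show "b x = 0" if "x \<notin> cball c r" for x
      using that s[of x] by (auto simp: b max_def)
  qed (use r in auto)
  then show "\<exists>G. test_function W b G" by blast
qed


text \<open>If countably many bumps \<open>b\<^sub>k\<close> have positivity sets covering \<open>W\<close>, the functions
  \<open>1 - \<Prod>k<m. (1 - b\<^sub>k)\<^sup>m\<close> do the job: one factor with \<open>b\<^sub>k x > 0\<close> drives the product to zero.\<close>

lemma test_functions_exhaust:
  fixes W :: "(real^'d) set"
  assumes "open W"
  obtains \<zeta> G where "\<And>m. test_function W (\<zeta> m) (G m)"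
    "\<And>m x. 0 \<le> \<zeta> m x" "\<And>m x. \<zeta> m x \<le> 1" "\<And>x. x \<in> W \<Longrightarrow> (\<lambda>m. \<zeta> m x) \<longlonglongrightarrow> 1"
proof -
  define bump where "bump b \<longleftrightarrow> (\<exists>G. test_function W b G) \<and> (\<forall>x. 0 \<le> b x \<and> b x \<le> 1)"
    for b :: "real^'d \<Rightarrow> real"
  define \<F> where "\<F> = (\<lambda>b. {x. b x > 0}) ` Collect bump"
  have opn: "open S" if S: "S \<in> \<F>" for S
  proof -
    obtain b where b: "bump b" "S = {x. 0 < b x}"
      using S unfolding \<F>_def by blast
    then have "continuous_on UNIV b"
      unfolding bump_def using test_function_continuous(1) by blast
    then show ?thesis using b by (auto intro!: open_Collect_less)
  qed
  have cover: "\<exists>S\<in>\<F>. x \<in> S" if x: "x \<in> W" for x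
  proof -
    obtain r where r: "r > 0" "cball x r \<subseteq> W" using open_contains_cball \<open>open W\<close> x by blast
    let ?b = "\<lambda>y. (max 0 (1 - ((y - x) \<bullet> (y - x)) / r\<^sup>2))\<^sup>2"
    have "bump ?b" unfolding bump_def using test_function_bump(1-3)[OF r] by blast
    then have "{y. ?b y > 0} \<in> \<F>" unfolding \<F>_def by (intro imageI CollectI)
    moreover have "?b x > 0" using r by simp
    ultimately show ?thesis by (intro bexI[of _ "{y. ?b y > 0}"]) simp_all
  qed
  obtain \<F>' where \<F>': "\<F>' \<subseteq> \<F>" "countable \<F>'" "\<Union>\<F>' = \<Union>\<F>"
    using Lindelof[of \<F>] opn by blast
  \<comment> \<open>The zero function contributes the empty set, so that the enumeration below runs
    over a nonempty family even when \<open>\<F>'\<close> is empty.\<close>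
  have "bump (\<lambda>x. 0)" unfolding bump_def using test_function_zero[of W] by (intro conjI exI) auto
  then have "{} \<in> \<F>" unfolding \<F>_def by (intro image_eqI[of _ _ "\<lambda>x. 0"]) auto
  define S where "S = from_nat_into (insert {} \<F>')"
  have rangeS: "range S = insert {} \<F>'"
    unfolding S_def using \<F>'(2) by (intro range_from_nat_into) auto
  have "\<exists>b. \<forall>k. bump (b k) \<and> S k = {x. b k x > 0}"
  proof (intro choice allI)
    fix k
    have "S k \<in> insert {} \<F>'" unfolding rangeS[symmetric] by (rule rangeI)
    then have "S k \<in> \<F>" using \<F>'(1) \<open>{} \<in> \<F>\<close> by auto
    then show "\<exists>b. bump b \<and> S k = {x. b x > 0}"
      unfolding \<F>_def by (elim imageE) (simp, blast)
  qed
  then obtain b where b: "\<And>k. bump (b k)" "\<And>k. S k = {x. b k x > 0}" by blast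
  \<comment> \<open>A single index is both the number of bumps and the exponent, so one limit brings
    in every bump and also makes its factor decay.\<close>
  define \<zeta> where "\<zeta> m x = 1 - (\<Prod>k<m. (1 - b k x) ^ m)" for m x
  have b01: "0 \<le> 1 - b k x" "1 - b k x \<le> 1" for k x using b(1)[of k] by (auto simp: bump_def)
  have ex: "\<exists>G. test_function W (\<zeta> m) G" for m
  proof -
    \<comment> \<open>Taking m copies of the same bump produces the m-th power.\<close>
    have "\<exists>G. test_function W (\<lambda>x. 1 - (\<Prod>i<m. 1 - b k x)) G" for k
      by (rule test_function_prod) (use b(1) in \<open>auto simp: bump_def\<close>)
    then have "\<exists>G. test_function W (\<lambda>x. 1 - (\<Prod>k<m. 1 - (1 - (1 - b k x) ^ m))) G"
      by (intro test_function_prod) simp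
    then show ?thesis unfolding \<zeta>_def[abs_def] by simp
  qed
  have conv: "(\<lambda>m. \<zeta> m x) \<longlonglongrightarrow> 1" if x: "x \<in> W" for x
  proof -
    obtain k where "x \<in> S k"
      using cover[OF x] \<F>'(3) rangeS by (metis Union_iff insertCI rangeE)
    then have k: "0 < b k x" using b(2) by auto
    have "(\<lambda>m. (1 - b k x) ^ m) \<longlonglongrightarrow> 0"
      using k b01[of k x] by (intro LIMSEQ_power_zero) auto
    then have "(\<lambda>m. 1 - \<zeta> m x) \<longlonglongrightarrow> 0"
    proof (rule Lim_null_comparison[rotated])
      show "\<forall>\<^sub>F m in sequentially. norm (1 - \<zeta> m x) \<le> (1 - b k x) ^ m"
      proof (rule eventually_sequentiallyI)
        \<comment> \<open>The bump with index k takes part only once m exceeds k.\<close>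
        fix m assume m: "Suc k \<le> m"
        have "(\<Prod>j<m. (1 - b j x) ^ m) = (1 - b k x) ^ m * (\<Prod>j\<in>{..<m} - {k}. (1 - b j x) ^ m)"
          using m by (subst prod.remove[of _ k]) auto
        also have "\<dots> \<le> (1 - b k x) ^ m * 1"
          using b01 by (intro mult_left_mono prod_le_1) (auto simp: power_le_one)
        finally show "norm (1 - \<zeta> m x) \<le> (1 - b k x) ^ m"
          using b01 by (simp add: \<zeta>_def prod_nonneg)
      qed
    qed
    from tendsto_diff[OF tendsto_const[of 1] this] show ?thesis by simp
  qed
  have "\<exists>G. \<forall>m. test_function W (\<zeta> m) (G m)" using ex by (intro choice) blast
  then obtain G where "\<And>m. test_function W (\<zeta> m) (G m)" by blast
  moreover have "0 \<le> \<zeta> m x" "\<zeta> m x \<le> 1" for m x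
    using b01 by (auto simp: \<zeta>_def intro!: prod_le_1 prod_nonneg power_le_one)
  ultimately show ?thesis using conv by (intro that) auto
qed


subsection \<open>Square integrable functions\<close>

lemma AE_lebesgue_onI:
  assumes "\<Omega> \<in> sets lebesgue" "negligible (\<Omega> - W)" "\<And>x. x \<in> \<Omega> \<Longrightarrow> x \<in> W \<Longrightarrow> P x"
  shows "AE x in lebesgue_on \<Omega>. P x"
proof -
  have "AE x in lebesgue. x \<in> \<Omega> \<longrightarrow> P x"
    using assms by (intro AE_I'[of "\<Omega> - W"]) (auto simp: negligible_iff_null_sets)
  then show ?thesis using assms(1) by (simp add: AE_restrict_space_iff)
qed

lemma L2_integrable_inner:
  assumes "f \<in> L2_on \<Omega>" "g \<in> L2_on \<Omega>"
  shows "integrable (lebesgue_on \<Omega>) (\<lambda>x. f x \<bullet> g x)"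
proof (rule Bochner_Integration.integrable_bound)
  show "integrable (lebesgue_on \<Omega>) (\<lambda>x. (norm (f x))\<^sup>2 + (norm (g x))\<^sup>2)"
    using assms by (auto simp: L2_on_def)
  show "(\<lambda>x. f x \<bullet> g x) \<in> borel_measurable (lebesgue_on \<Omega>)"
    using assms by (auto simp: L2_on_def)
  show "AE x in lebesgue_on \<Omega>. norm (f x \<bullet> g x) \<le> norm ((norm (f x))\<^sup>2 + (norm (g x))\<^sup>2)"
  proof (rule AE_I2)
    fix x
    have "\<bar>f x \<bullet> g x\<bar> \<le> norm (f x) * norm (g x)" by (rule Cauchy_Schwarz_ineq2)
    also have "\<dots> \<le> (norm (f x))\<^sup>2 + (norm (g x))\<^sup>2"
      using sum_squares_bound[of "norm (f x)" "norm (g x)"]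
        mult_nonneg_nonneg[OF norm_ge_zero norm_ge_zero, of "f x" "g x"] by linarith
    finally show "norm (f x \<bullet> g x) \<le> norm ((norm (f x))\<^sup>2 + (norm (g x))\<^sup>2)" by simp
  qed
qed

lemma L2_bounded:
  assumes "\<Omega> \<in> lmeasurable" "f \<in> borel_measurable (lebesgue_on \<Omega>)"
    "AE x in lebesgue_on \<Omega>. norm (f x) \<le> B"
  shows "f \<in> L2_on \<Omega>"
proof -
  interpret finite_measure "lebesgue_on \<Omega>" by (rule finite_measure_lebesgue_on[OF assms(1)])
  have "integrable (lebesgue_on \<Omega>) (\<lambda>x. (norm (f x))\<^sup>2)"
    by (rule integrable_const_bound[of _ "B\<^sup>2"])
       (use assms(2,3) in \<open>auto elim!: eventually_mono intro: power_mono\<close>)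
  then show ?thesis using assms by (simp add: L2_on_def)
qed

lemma L2_const: "\<Omega> \<in> lmeasurable \<Longrightarrow> (\<lambda>x. c) \<in> L2_on \<Omega>"
  by (rule L2_bounded[of _ _ "norm c"]) auto

lemma L2_integrable:
  fixes f :: "real^'d \<Rightarrow> 'b::euclidean_space"
  assumes "\<Omega> \<in> lmeasurable" "f \<in> L2_on \<Omega>"
  shows "integrable (lebesgue_on \<Omega>) f"
proof (rule Bochner_Integration.integrable_bound)
  interpret finite_measure "lebesgue_on \<Omega>" by (rule finite_measure_lebesgue_on[OF assms(1)])
  show "integrable (lebesgue_on \<Omega>) (\<lambda>x. 1 + (norm (f x))\<^sup>2)"
    using assms(2) by (auto simp: L2_on_def)
  show "f \<in> borel_measurable (lebesgue_on \<Omega>)" using assms(2) by (simp add: L2_on_def)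
  show "AE x in lebesgue_on \<Omega>. norm (f x) \<le> norm (1 + (norm (f x))\<^sup>2)"
  proof (rule AE_I2)
    fix x
    have "norm (f x) \<le> 1 + (norm (f x))\<^sup>2"
      using sum_squares_bound[of 1 "norm (f x)"] norm_ge_zero[of "f x"] by (simp, linarith)
    then show "norm (f x) \<le> norm (1 + (norm (f x))\<^sup>2)" by simp
  qed
qed

lemma L2_inner_add_left:
  assumes "f \<in> L2_on \<Omega>" "g \<in> L2_on \<Omega>" "h \<in> L2_on \<Omega>"
  shows "L2_inner \<Omega> (\<lambda>x. f x + g x) h = L2_inner \<Omega> f h + L2_inner \<Omega> g h"
  unfolding L2_inner_def inner_add_left
  by (rule Bochner_Integration.integral_add; rule L2_integrable_inner; fact)

lemma L2_inner_cmul_left: "L2_inner \<Omega> (\<lambda>x. c * f x) h = c * L2_inner \<Omega> f h"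
  unfolding L2_inner_def by (simp add: mult.assoc)

lemma L2_inner_sum_left:
  fixes h :: "real^'d \<Rightarrow> real"
  assumes "\<And>i. i \<in> I \<Longrightarrow> f i \<in> L2_on \<Omega>" "h \<in> L2_on \<Omega>"
  shows "L2_inner \<Omega> (\<lambda>x. \<Sum>i\<in>I. f i x) h = (\<Sum>i\<in>I. L2_inner \<Omega> (f i) h)"
  unfolding L2_inner_def inner_sum_left
  by (rule Bochner_Integration.integral_sum, rule L2_integrable_inner) (use assms in auto)

lemma test_function_L2:
  assumes "\<Omega> \<in> lmeasurable" "test_function W \<zeta> G"
  shows "\<zeta> \<in> L2_on \<Omega>" "G \<in> L2_on \<Omega>"
proof -
  define S where "S = closure {x. \<zeta> x \<noteq> 0}"
  note S = test_function_support[OF assms(2), folded S_def]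
  have *: "f \<in> L2_on \<Omega>" if cont: "continuous_on UNIV f" and 0: "\<And>x. x \<notin> S \<Longrightarrow> f x = 0"
    for f :: "real^'a \<Rightarrow> 'b::euclidean_space"
  proof -
    have "bounded (f ` S)"
      by (intro compact_imp_bounded compact_continuous_image continuous_on_subset[OF cont] S(1)) simp
    then obtain B where B: "\<And>x. x \<in> S \<Longrightarrow> norm (f x) \<le> B"
      unfolding bounded_iff by auto
    have "norm (f x) \<le> max B 0" for x using B[of x] 0[of x] by (cases "x \<in> S") auto
    then have "AE x in lebesgue_on \<Omega>. norm (f x) \<le> max B 0" by blast
    moreover have "f \<in> borel_measurable lborel"
      using borel_measurable_continuous_onI[OF cont] by simp
    then have "f \<in> borel_measurable (lebesgue_on \<Omega>)"
      by (intro measurable_restrict_space1 measurable_completion)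
    ultimately show ?thesis using assms(1) by (intro L2_bounded)
  qed
  show "\<zeta> \<in> L2_on \<Omega>" by (rule *[OF test_function_continuous(1)[OF assms(2)] S(3)])
  show "G \<in> L2_on \<Omega>" by (rule *[OF test_function_continuous(2)[OF assms(2)] S(4)])
qed

text \<open>Leads from the domain to the whole space, where translation invariance makes the
  integrals of derivatives vanish.\<close>

lemma integral_lebesgue_on_eq_lborel:
  fixes f :: "'a::euclidean_space \<Rightarrow> real"
  assumes "\<Omega> \<in> sets lebesgue" "f \<in> borel_measurable borel" "\<And>x. x \<notin> \<Omega> \<Longrightarrow> f x = 0"
  shows "(LINT x|lebesgue_on \<Omega>. f x) = (LINT x|lborel. f x)"
proof -
  have "(\<lambda>x. indicator \<Omega> x *\<^sub>R f x) = f" using assms(3) by (auto simp: indicator_def fun_eq_iff)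
  then show ?thesis using assms by (simp add: integral_restrict_space integral_completion)
qed


subsection \<open>The divergence has mean value zero\<close>

text \<open>Makes the constant one admissible in the normal trace. What has to vanish is the
  integral of the gradient of a test function; scalar products reduce this to directional
  derivatives.\<close>

lemma weak_gradient_const:
  fixes \<Omega> :: "(real^'d) set"
  assumes "\<Omega> \<in> lmeasurable"
  shows "weak_gradient \<Omega> (\<lambda>x. c) (\<lambda>x. 0)"
  unfolding weak_gradient_def
proof (intro conjI allI impI L2_const assms)
  fix \<zeta> :: "real^'d \<Rightarrow> real" and G assume t: "test_function \<Omega> \<zeta> G"
  define S where "S = closure {x. \<zeta> x \<noteq> 0}"
  note S = test_function_support[OF t, folded S_def]
  have "(LINT x|lebesgue_on \<Omega>. G x) \<bullet> a = 0" for a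
  proof -
    have "(LINT x|lebesgue_on \<Omega>. G x) \<bullet> a = (LINT x|lebesgue_on \<Omega>. a \<bullet> G x)"
      using L2_integrable[OF assms test_function_L2(2)[OF assms t]]
      by (simp add: inner_commute[of a])
    also have "\<dots> = (LINT x|lborel. a \<bullet> G x)"
    proof (rule integral_lebesgue_on_eq_lborel)
      show "\<Omega> \<in> sets lebesgue" using assms by (rule fmeasurableD)
      show "(\<lambda>x. a \<bullet> G x) \<in> borel_measurable borel"
        by (intro borel_measurable_continuous_onI continuous_intros test_function_continuous(2)[OF t])
      show "a \<bullet> G x = 0" if "x \<notin> \<Omega>" for x
      proof -
        have "x \<notin> S" using that S(2) by blast
        then show ?thesis by (simp add: S(4))
      qed
    qed
    also have "\<dots> = 0"
    proof (rule integral_directional_derivative_eq_0[OF _ test_function_continuous(2)[OF t] S(1) S(3)])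
      show "GDERIV \<zeta> x :> G x" for x using t by (simp add: test_function_def)
    qed
    finally show ?thesis .
  qed
  \<comment> \<open>Tested with itself, the vector has norm zero.\<close>
  from this[of "LINT x|lebesgue_on \<Omega>. G x"] have "(LINT x|lebesgue_on \<Omega>. G x) = 0"
    unfolding inner_eq_zero_iff .
  then show "(LINT x|lebesgue_on \<Omega>. c *\<^sub>R G x) = - (LINT x|lebesgue_on \<Omega>. \<zeta> x *\<^sub>R 0)"
    by simp
qed

text \<open>The field is differentiable only on \<open>W\<close>, but its product with \<zeta>,
  whose support is compact in \<open>W\<close>, is C1 on the whole space. The partial derivatives of
  the product integrate to zero, and no boundary term arises.\<close>

lemma integration_by_parts_test_function:
  fixes u :: "real^'d \<Rightarrow> real^'d"
  assumes "\<Omega> \<in> lmeasurable" "open W" "W \<subseteq> \<Omega>" and t: "test_function W \<zeta> G"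
    and D: "\<And>j x. x \<in> W \<Longrightarrow> GDERIV (\<lambda>y. u y $ j) x :> D j x" "\<And>j. continuous_on W (D j)"
    and L2: "u \<in> L2_on \<Omega>" "divg u \<in> L2_on \<Omega>"
  shows "L2_inner \<Omega> u G = - L2_inner \<Omega> (divg u) \<zeta>"
proof -
  define S where "S = closure {x. \<zeta> x \<noteq> 0}"
  note S = test_function_support[OF t, folded S_def]
  \<comment> \<open>Two open sets cover the space: on \<open>W\<close> the product rule applies, and
    off the support everything is zero.\<close>
  have cover: "W \<union> - S = UNIV" using S(2) by blast
  have opS: "open (- S)" using S(1) compact_imp_closed by blast
  define H where "H j x = (if x \<in> S then \<zeta> x *\<^sub>R D j x + (u x $ j) *\<^sub>R G x else 0)" for j x
  have HW: "H j x = \<zeta> x *\<^sub>R D j x + (u x $ j) *\<^sub>R G x" for j x using S by (simp add: H_def)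
  have deriv: "GDERIV (\<lambda>y. \<zeta> y * u y $ j) x :> H j x" for j x
  proof (cases "x \<in> S")
    case True
    then have "x \<in> W" using S(2) by blast
    then show ?thesis
      unfolding HW using t D(1)[of x j] unfolding test_function_def by (intro GDERIV_mult) auto
  next
    case False
    have "((\<lambda>y. \<zeta> y * u y $ j) has_derivative (\<lambda>v. 0)) (at x)"
      by (rule has_derivative_transform_within_open[of "\<lambda>x. 0" _ _ UNIV "- S"])
         (use opS False S(3) in auto)
    then show ?thesis using False by (simp add: gderiv_def H_def)
  qed
  have "isCont (\<lambda>y. u y $ j) x" if "x \<in> W" for j x
    using D(1)[OF that, of j] unfolding gderiv_def by (rule has_derivative_continuous)
  then have contu: "continuous_on W (\<lambda>y. u y $ j)" for j
    by (simp add: continuous_at_imp_continuous_on)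
  have contH: "continuous_on UNIV (H j)" for j
    unfolding cover[symmetric]
  proof (intro continuous_on_open_Un \<open>open W\<close> opS)
    show "continuous_on W (H j)"
      unfolding HW[abs_def] by (intro continuous_intros contu D test_function_continuous[OF t])
    show "continuous_on (- S) (H j)"
      by (rule continuous_on_eq[of _ "\<lambda>x. 0"]) (auto simp: H_def)
  qed
  have H0: "H j x = 0" if "x \<notin> S" for j x using that by (simp add: H_def)
  have contH': "continuous_on UNIV (\<lambda>x. axis j 1 \<bullet> H j x)" for j
    by (intro continuous_intros contH)
  \<comment> \<open>Both sides are div (\<zeta> u). Off the support they vanish, whatever the value
    of \<open>divg u\<close> there.\<close>
  have eq: "u x \<bullet> G x + divg u x \<bullet> \<zeta> x = (\<Sum>j\<in>UNIV. axis j 1 \<bullet> H j x)" for x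
  proof (cases "x \<in> S")
    case True
    then have "divg u x = (\<Sum>j\<in>UNIV. D j x $ j)"
      using S(2) D(1) by (intro divg_GDERIV) auto
    moreover have "axis j 1 \<bullet> H j x = D j x $ j * \<zeta> x + u x $ j * G x $ j" for j
      by (simp add: HW inner_axis')
    ultimately show ?thesis by (simp add: sum.distrib sum_distrib_right inner_vec_def)
  qed (simp add: H0 S)
  have "L2_inner \<Omega> u G + L2_inner \<Omega> (divg u) \<zeta> = (LINT x|lebesgue_on \<Omega>. u x \<bullet> G x + divg u x \<bullet> \<zeta> x)"
    unfolding L2_inner_def using L2 test_function_L2[OF assms(1) t]
    by (intro Bochner_Integration.integral_add[symmetric] L2_integrable_inner)
  also have "\<dots> = (LINT x|lborel. (\<Sum>j\<in>UNIV. axis j 1 \<bullet> H j x))"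
    unfolding eq
  proof (rule integral_lebesgue_on_eq_lborel[OF fmeasurableD[OF assms(1)]])
    show "(\<lambda>x. \<Sum>j\<in>UNIV. axis j 1 \<bullet> H j x) \<in> borel_measurable borel"
      by (intro borel_measurable_continuous_onI continuous_on_sum contH')
    show "(\<Sum>j\<in>UNIV. axis j 1 \<bullet> H j x) = 0" if "x \<notin> \<Omega>" for x
    proof -
      have "x \<notin> S" using that S(2) assms(3) by blast
      then show ?thesis by (simp add: H0)
    qed
  qed
  also have "\<dots> = (\<Sum>j\<in>UNIV. LINT x|lborel. axis j 1 \<bullet> H j x)"
    by (intro Bochner_Integration.integral_sum integrable_compact_support[OF contH' S(1)]) (simp add: H0)
  also have "\<dots> = 0"
    using S(3) by (intro sum.neutral ballI integral_directional_derivative_eq_0[OF deriv contH S(1)]) simp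
  finally show ?thesis by linarith
qed

text \<open>The weak divergence \<open>w\<close> and the classical one have the same integral against every cut-off
  function supported in \<open>W\<close>; exhausting \<open>W\<close> gives the same integral over \<open>\<Omega>\<close>.  Pairing the
  normal trace with the constant one shows that the integral of \<open>w\<close> is zero.\<close>

lemma integral_divg_eq_0:
  fixes u :: "real^'d \<Rightarrow> real^'d"
  assumes \<Omega>: "\<Omega> \<in> lmeasurable" and W: "open W" "W \<subseteq> \<Omega>" "negligible (\<Omega> - W)"
    and u: "u \<in> Hdiv \<Omega>" "zero_normal_trace \<Omega> u"
    and D: "\<And>j x. x \<in> W \<Longrightarrow> GDERIV (\<lambda>y. u y $ j) x :> D j x" "\<And>j. continuous_on W (D j)"
    and L2: "divg u \<in> L2_on \<Omega>"
  shows "(LINT x|lebesgue_on \<Omega>. divg u x) = 0"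
proof -
  obtain w where w: "weak_divergence \<Omega> u w" using u(1) by (auto simp: Hdiv_def)
  then have uL2: "u \<in> L2_on \<Omega>" and wL2: "w \<in> L2_on \<Omega>" by (auto simp: weak_divergence_def)
  \<comment> \<open>For \<phi> = 1 with gradient 0 the trace functional reduces to the integral of
    \<open>w\<close>.\<close>
  have w0: "(LINT x|lebesgue_on \<Omega>. w x) = 0"
    using u(2) w weak_gradient_const[OF \<Omega>, of 1] by (fastforce simp: zero_normal_trace_def L2_inner_def)
  obtain \<zeta> G where t: "\<And>m. test_function W (\<zeta> m) (G m)"
    and \<zeta>: "\<And>m x. 0 \<le> \<zeta> m x" "\<And>m x. \<zeta> m x \<le> 1" "\<And>x. x \<in> W \<Longrightarrow> (\<lambda>m. \<zeta> m x) \<longlonglongrightarrow> 1"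
    by (rule test_functions_exhaust[OF W(1)]) (rule that; assumption)
  have eq: "L2_inner \<Omega> w (\<zeta> m) = L2_inner \<Omega> (divg u) (\<zeta> m)" for m
  proof -
    have "L2_inner \<Omega> u (G m) = - L2_inner \<Omega> w (\<zeta> m)"
      using w test_function_mono[OF t W(2)] by (simp add: weak_divergence_def)
    with integration_by_parts_test_function[OF \<Omega> W(1,2) t D uL2 L2, of m] show ?thesis
      by linarith
  qed
  \<comment> \<open>The cut-offs lie between 0 and 1, so the modulus of f dominates; it is
    integrable because \<Omega> has finite measure.\<close>
  have lim: "(\<lambda>m. L2_inner \<Omega> f (\<zeta> m)) \<longlonglongrightarrow> (LINT x|lebesgue_on \<Omega>. f x)" if f: "f \<in> L2_on \<Omega>" for f
    unfolding L2_inner_def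
  proof (rule integral_dominated_convergence[where w = "\<lambda>x. \<bar>f x\<bar>"])
    show "f \<in> borel_measurable (lebesgue_on \<Omega>)" using f by (simp add: L2_on_def)
    show "integrable (lebesgue_on \<Omega>) (\<lambda>x. \<bar>f x\<bar>)" using L2_integrable[OF \<Omega> f] by simp
    show "(\<lambda>x. f x \<bullet> \<zeta> m x) \<in> borel_measurable (lebesgue_on \<Omega>)" for m
      using L2_integrable_inner[OF f test_function_L2(1)[OF \<Omega> t]] by blast
    show "AE x in lebesgue_on \<Omega>. (\<lambda>m. f x \<bullet> \<zeta> m x) \<longlonglongrightarrow> f x"
    proof (rule AE_lebesgue_onI[OF _ W(3)])
      show "(\<lambda>m. f x \<bullet> \<zeta> m x) \<longlonglongrightarrow> f x" if "x \<in> W" for x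
        using tendsto_mult[OF tendsto_const[of "f x"] \<zeta>(3)[OF that]] by simp
    qed (use \<Omega> in \<open>auto dest: fmeasurableD\<close>)
    show "AE x in lebesgue_on \<Omega>. norm (f x \<bullet> \<zeta> m x) \<le> \<bar>f x\<bar>" for m
      using \<zeta>(1,2) by (auto simp: abs_mult intro!: mult_left_le)
  qed
  show ?thesis
    using LIMSEQ_unique[OF lim[OF wL2, unfolded eq] lim[OF L2]] w0 by simp
qed


subsection \<open>Piecewise polynomials on a mesh\<close>

text \<open>The intersection with \<Omega> is there because the mesh covers the closure of \<Omega>,
  so that interiors of simplices are only known to lie in that closure.\<close>

definition mesh_interior :: "(real^'d) set \<Rightarrow> (real^'d) set set \<Rightarrow> (real^'d) set" where
  "mesh_interior \<Omega> T = \<Omega> \<inter> (\<Union>K\<in>T. interior K)"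

lemma mesh_simplex:
  fixes T :: "(real^'d) set set"
  assumes "mesh_of \<Omega> T" "K \<in> T"
  shows "convex K" "compact K" "interior K \<noteq> {}" "interior K \<subseteq> closure \<Omega>"
proof -
  have K: "int CARD('d) simplex K" using assms by (simp add: mesh_of_def)
  show "convex K" "compact K" using K convex_simplex compact_simplex by auto
  \<comment> \<open>Full dimension turns the relative interior, nonempty for a nonempty convex set,
    into the interior.\<close>
  have "aff_dim K = int CARD('d)" using K by (rule aff_dim_simplex)
  then have "rel_interior K = interior K" "K \<noteq> {}" by (auto simp: interior_rel_interior)
  then show "interior K \<noteq> {}" using \<open>convex K\<close> rel_interior_eq_empty by blast
  have "K \<subseteq> closure \<Omega>" using assms unfolding mesh_of_def by blast
  then show "interior K \<subseteq> closure \<Omega>" using interior_subset by blast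
qed

text \<open>A point of \<Omega> in no open simplex lies on the frontier of a closed one. Frontiers
  of convex sets are null, and the mesh is finite.\<close>

lemma negligible_skeleton:
  assumes "mesh_of \<Omega> T"
  shows "negligible (\<Omega> - mesh_interior \<Omega> T)"
proof (rule negligible_subset)
  show "negligible (\<Union>(frontier ` T))"
    using assms mesh_simplex(1)[OF assms]
    by (intro negligible_Union) (auto simp: mesh_of_def triangulation_def negligible_convex_frontier)
  show "\<Omega> - mesh_interior \<Omega> T \<subseteq> \<Union>(frontier ` T)"
  proof
    fix x assume x: "x \<in> \<Omega> - mesh_interior \<Omega> T"
    then have "x \<in> \<Union>T"
      using assms closure_subset[of \<Omega>] unfolding mesh_of_def by auto
    then obtain K where K: "K \<in> T" "x \<in> K" by blast
    then have "x \<notin> interior K" using x by (auto simp: mesh_interior_def)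
    then show "x \<in> \<Union>(frontier ` T)" using K closure_subset[of K] by (auto simp: frontier_def)
  qed
qed

lemma open_mesh_interior: "open \<Omega> \<Longrightarrow> open (mesh_interior \<Omega> T)"
  unfolding mesh_interior_def by auto

text \<open>The local condition of \<open>P_h\<close> alone. On a bounded domain it implies square
  integrability, so that only the mean value remains as a further condition.\<close>

definition piecewise_polys :: "(real^'d) set set \<Rightarrow> nat \<Rightarrow> (real^'d \<Rightarrow> real) set" where
  "piecewise_polys T k = {q. \<forall>K\<in>T. \<exists>r\<in>polys k. \<forall>x\<in>interior K. q x = r x}"

lemma piecewise_polysE:
  assumes "q \<in> piecewise_polys T k" "K \<in> T"
  obtains r where "r \<in> polys k" "\<And>x. x \<in> interior K \<Longrightarrow> q x = r x"
  using assms unfolding piecewise_polys_def by blast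

lemma piecewise_polys_add:
  assumes "p \<in> piecewise_polys T k" "q \<in> piecewise_polys T k"
  shows "(\<lambda>x. p x + q x) \<in> piecewise_polys T k"
  unfolding piecewise_polys_def
proof (intro CollectI ballI)
  fix K assume "K \<in> T"
  obtain r where r: "r \<in> polys k" "\<And>x. x \<in> interior K \<Longrightarrow> p x = r x"
    by (rule piecewise_polysE[OF assms(1) \<open>K \<in> T\<close>]) (rule that)
  obtain s where s: "s \<in> polys k" "\<And>x. x \<in> interior K \<Longrightarrow> q x = s x"
    by (rule piecewise_polysE[OF assms(2) \<open>K \<in> T\<close>]) (rule that)
  show "\<exists>r\<in>polys k. \<forall>x\<in>interior K. p x + q x = r x"
    using r s by (intro bexI[of _ "\<lambda>x. r x + s x"] polys_add) auto
qed

lemma piecewise_polys_cmul: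
  assumes "p \<in> piecewise_polys T k"
  shows "(\<lambda>x. c * p x) \<in> piecewise_polys T k"
  unfolding piecewise_polys_def
proof (intro CollectI ballI)
  fix K assume "K \<in> T"
  obtain r where r: "r \<in> polys k" "\<And>x. x \<in> interior K \<Longrightarrow> p x = r x"
    by (rule piecewise_polysE[OF assms \<open>K \<in> T\<close>]) (rule that)
  show "\<exists>r\<in>polys k. \<forall>x\<in>interior K. c * p x = r x"
    using r by (intro bexI[of _ "\<lambda>x. c * r x"] polys_cmul) auto
qed

lemma piecewise_polys_continuous_on:
  assumes "q \<in> piecewise_polys T k"
  shows "continuous_on (mesh_interior \<Omega> T) q"
proof -
  have "continuous_on (\<Union>K\<in>T. interior K) q"
  proof (rule continuous_on_open_UN)
    fix K assume "K \<in> T"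
    obtain r where r: "r \<in> polys k" "\<And>x. x \<in> interior K \<Longrightarrow> q x = r x"
      by (rule piecewise_polysE[OF assms \<open>K \<in> T\<close>]) (rule that)
    show "continuous_on (interior K) q"
      by (rule continuous_on_eq[OF polys_continuous_on[OF r(1)]]) (simp add: r(2))
  qed simp
  then show ?thesis by (rule continuous_on_subset) (simp add: mesh_interior_def)
qed

lemma piecewise_polys_bounded:
  assumes "mesh_of \<Omega> T" "q \<in> piecewise_polys T k"
  shows "bounded (q ` mesh_interior \<Omega> T)"
proof (rule bounded_subset)
  show "bounded (\<Union>K\<in>T. q ` interior K)"
  proof (rule bounded_UN[rule_format])
    show "finite T" using assms(1) by (simp add: mesh_of_def triangulation_def)
    fix K assume "K \<in> T"
    obtain r where r: "r \<in> polys k" "\<And>x. x \<in> interior K \<Longrightarrow> q x = r x"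
      by (rule piecewise_polysE[OF assms(2) \<open>K \<in> T\<close>]) (rule that)
    have "bounded (r ` K)"
      using mesh_simplex(2)[OF assms(1) \<open>K \<in> T\<close>] polys_continuous_on[OF r(1)]
      by (intro compact_imp_bounded compact_continuous_image)
    moreover have "q ` interior K \<subseteq> r ` K" using r(2) interior_subset[of K] by auto
    ultimately show "bounded (q ` interior K)" by (rule bounded_subset)
  qed
  show "q ` mesh_interior \<Omega> T \<subseteq> (\<Union>K\<in>T. q ` interior K)" by (auto simp: mesh_interior_def)
qed

text \<open>The values on the skeleton are arbitrary, so q need not be Borel. Its modification by
  zero there is Borel, and the two agree off a null set, which suffices for Lebesgue
  measurability.\<close>

lemma piecewise_polys_L2:
  assumes "open \<Omega>" "bounded \<Omega>" "mesh_of \<Omega> T" "q \<in> piecewise_polys T k"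
  shows "q \<in> L2_on \<Omega>"
proof -
  have \<Omega>: "\<Omega> \<in> lmeasurable" using assms by (intro lmeasurable_open)
  let ?W = "mesh_interior \<Omega> T"
  obtain B where B: "\<And>x. x \<in> ?W \<Longrightarrow> norm (q x) \<le> B"
    using piecewise_polys_bounded[OF assms(3,4)] unfolding bounded_iff by auto
  have "(\<lambda>x. if x \<in> ?W then q x else 0) \<in> borel_measurable borel"
    using open_mesh_interior[OF assms(1)] piecewise_polys_continuous_on[OF assms(4)]
    by (intro borel_measurable_continuous_on_if) auto
  then have "(\<lambda>x. if x \<in> ?W then q x else 0) \<in> borel_measurable lebesgue"
    by (intro measurable_completion) simp
  moreover have "AE x in lebesgue. (if x \<in> ?W then q x else 0) = (if x \<in> \<Omega> then q x else 0)"
    using negligible_skeleton[OF assms(3)]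
    by (intro AE_I'[of "\<Omega> - ?W"]) (auto simp: negligible_iff_null_sets mesh_interior_def)
  ultimately have "(\<lambda>x. if x \<in> \<Omega> then q x else 0) \<in> borel_measurable lebesgue"
    by (rule borel_measurable_AE)
  then have "q \<in> borel_measurable (lebesgue_on \<Omega>)" by (rule borel_measurable_if_D)
  moreover have "AE x in lebesgue_on \<Omega>. norm (q x) \<le> B"
    by (rule AE_lebesgue_onI[OF fmeasurableD[OF \<Omega>] negligible_skeleton[OF assms(3)] B])
  ultimately show ?thesis using \<Omega> by (intro L2_bounded)
qed

lemma P_h_iff:
  assumes "open \<Omega>" "bounded \<Omega>" "mesh_of \<Omega> T"
  shows "q \<in> P_h \<Omega> T l \<longleftrightarrow> q \<in> piecewise_polys T (l - 1) \<and> (LINT x | lebesgue_on \<Omega>. q x) = 0"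
  using piecewise_polys_L2[OF assms] unfolding P_h_def piecewise_polys_def by blast

lemma P_h_L2: "q \<in> P_h \<Omega> T l \<Longrightarrow> q \<in> L2_on \<Omega>"
  by (simp add: P_h_def)

lemma P_h_add:
  assumes "open \<Omega>" "bounded \<Omega>" "mesh_of \<Omega> T" "p \<in> P_h \<Omega> T l" "q \<in> P_h \<Omega> T l"
  shows "(\<lambda>x. p x + q x) \<in> P_h \<Omega> T l"
  using assms(4,5) L2_integrable[OF lmeasurable_open[OF assms(2,1)] P_h_L2[OF assms(4)]]
    L2_integrable[OF lmeasurable_open[OF assms(2,1)] P_h_L2[OF assms(5)]]
  unfolding P_h_iff[OF assms(1-3)] by (simp add: piecewise_polys_add)

lemma P_h_cmul:
  assumes "open \<Omega>" "bounded \<Omega>" "mesh_of \<Omega> T" "p \<in> P_h \<Omega> T l"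
  shows "(\<lambda>x. c * p x) \<in> P_h \<Omega> T l"
  using assms(4) unfolding P_h_iff[OF assms(1-3)] by (simp add: piecewise_polys_cmul)

lemma P_h_zero: "(\<lambda>x. 0) \<in> P_h \<Omega> T l"
  by (auto simp: P_h_def L2_on_def intro!: bexI[of _ "\<lambda>x. 0"] polys_zero)

lemma P_h_sum:
  assumes "open \<Omega>" "bounded \<Omega>" "mesh_of \<Omega> T" "\<And>i. i \<in> I \<Longrightarrow> p i \<in> P_h \<Omega> T l"
  shows "(\<lambda>x. \<Sum>i\<in>I. p i x) \<in> P_h \<Omega> T l"
  using assms(4)
  by (induction I rule: infinite_finite_induct) (auto intro: P_h_zero P_h_add[OF assms(1-3)])

section \<open>Continuous extension to closed simplices\<close>

lemma restr_eq:
  fixes q :: "real^'d \<Rightarrow> 'b::euclidean_space"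
  assumes "mesh_of \<Omega> T" "K \<in> T" "x \<in> K"
    and "isCont r x" "\<And>y. y \<in> interior K \<Longrightarrow> q y = r y"
  shows "restr K q x = r x"
proof -
  \<comment> \<open>\<open>Lim\<close> is determined only if x can be approached from the interior.
    For a convex set with nonempty interior this holds at every point, also on the frontier.\<close>
  have "x islimpt interior K"
  proof (cases "x \<in> interior K")
    case True
    then show ?thesis by (intro open_imp_islimpt) auto
  next
    case False
    moreover have "x \<in> closure (interior K)"
      using convex_closure_interior[OF mesh_simplex(1,3)[OF assms(1,2)]] \<open>x \<in> K\<close> closure_subset
      by blast
    ultimately show ?thesis by (auto simp: closure_def)
  qed
  then have nontriv: "at x within interior K \<noteq> bot"
    using trivial_limit_within trivial_limit_def by blast
  have "(r \<longlongrightarrow> r x) (at x within interior K)"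
    using \<open>isCont r x\<close> by (meson continuous_within continuous_within_subset subset_UNIV)
  moreover have "\<forall>\<^sub>F y in at x within interior K. r y = q y"
    using assms(5) by (auto simp: eventually_at_filter)
  ultimately have "(q \<longlongrightarrow> r x) (at x within interior K)"
    using tendsto_cong by blast
  then show ?thesis unfolding restr_def by (rule tendsto_Lim[OF nontriv])
qed

lemma restr_piecewise_polys:
  assumes "mesh_of \<Omega> T" "K \<in> T" "x \<in> K" "r \<in> polys k" "\<And>y. y \<in> interior K \<Longrightarrow> q y = r y"
  shows "restr K q x = r x"
proof (rule restr_eq[OF assms(1-3) _ assms(5)])
  show "isCont r x"
    using polys_continuous_on[OF assms(4), of UNIV] by (simp add: continuous_on_eq_continuous_at)
qed

text \<open>\<open>Lim\<close> is additive only where the limits exist; polynomials on each simplex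
  guarantee that they do.\<close>

lemma restr_add:
  assumes "mesh_of \<Omega> T" "K \<in> T" "x \<in> K" "p \<in> piecewise_polys T k" "q \<in> piecewise_polys T k"
  shows "restr K (\<lambda>x. p x + q x) x = restr K p x + restr K q x"
proof -
  obtain r where r: "r \<in> polys k" "\<And>x. x \<in> interior K \<Longrightarrow> p x = r x"
    by (rule piecewise_polysE[OF assms(4,2)]) (rule that)
  obtain s where s: "s \<in> polys k" "\<And>x. x \<in> interior K \<Longrightarrow> q x = s x"
    by (rule piecewise_polysE[OF assms(5,2)]) (rule that)
  show ?thesis
    using restr_piecewise_polys[OF assms(1-3) r] restr_piecewise_polys[OF assms(1-3) s]
      restr_piecewise_polys[OF assms(1-3) polys_add[OF r(1) s(1)], of "\<lambda>x. p x + q x"]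
    by (simp add: r(2) s(2))
qed

lemma restr_cmul:
  assumes "mesh_of \<Omega> T" "K \<in> T" "x \<in> K" "p \<in> piecewise_polys T k"
  shows "restr K (\<lambda>x. c * p x) x = c * restr K p x"
proof -
  obtain r where r: "r \<in> polys k" "\<And>x. x \<in> interior K \<Longrightarrow> p x = r x"
    by (rule piecewise_polysE[OF assms(4,2)]) (rule that)
  show ?thesis
    using restr_piecewise_polys[OF assms(1-3) r]
      restr_piecewise_polys[OF assms(1-3) polys_cmul[OF r(1)], of "\<lambda>x. c * p x" c]
    by (simp add: r(2))
qed

lemma restr_zero: "mesh_of \<Omega> T \<Longrightarrow> K \<in> T \<Longrightarrow> x \<in> K \<Longrightarrow> restr K (\<lambda>x. 0::real) x = 0"
  by (rule restr_piecewise_polys[of _ _ _ _ "\<lambda>x. 0"]) (auto intro: polys_zero)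

lemma piecewise_polys_zero: "(\<lambda>x. 0) \<in> piecewise_polys T k"
  by (auto simp: piecewise_polys_def intro!: bexI[of _ "\<lambda>x. 0"] polys_zero)

lemma piecewise_polys_sum:
  "(\<And>i. i \<in> I \<Longrightarrow> p i \<in> piecewise_polys T k) \<Longrightarrow> (\<lambda>x. \<Sum>i\<in>I. p i x) \<in> piecewise_polys T k"
  by (induction I rule: infinite_finite_induct) (auto intro: piecewise_polys_zero piecewise_polys_add)

lemma restr_sum:
  assumes "mesh_of \<Omega> T" "K \<in> T" "x \<in> K" "\<And>i. i \<in> I \<Longrightarrow> p i \<in> piecewise_polys T k"
  shows "restr K (\<lambda>x. \<Sum>i\<in>I. p i x) x = (\<Sum>i\<in>I. restr K (p i) x)"
  using assms(4)
proof (induction I rule: infinite_finite_induct)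
  case (insert i I)
  have "restr K (\<lambda>x. p i x + (\<Sum>i\<in>I. p i x)) x = restr K (p i) x + restr K (\<lambda>x. \<Sum>i\<in>I. p i x) x"
    by (rule restr_add[OF assms(1-3), of _ k]) (auto intro: insert.prems piecewise_polys_sum)
  then show ?case using insert by simp
qed (simp_all add: restr_zero[OF assms(1-3)])

text \<open>The difference lies in \<open>P_h\<close> and may be tested with itself, so it vanishes
  almost everywhere. On a simplex it is a polynomial, and the set where it is nonzero is open; an
  open null set is empty.\<close>

lemma restr_eq_if_moments_eq:
  assumes \<Omega>: "open \<Omega>" "bounded \<Omega>" and mesh: "mesh_of \<Omega> T" and K: "K \<in> T" "x \<in> K"
    and a: "a \<in> P_h \<Omega> T l" and b: "b \<in> P_h \<Omega> T l"
    and eq: "\<And>s. s \<in> P_h \<Omega> T l \<Longrightarrow> L2_inner \<Omega> a s = L2_inner \<Omega> b s"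
  shows "restr K a x = restr K b x"
proof -
  define d where "d x = a x + (- 1) * b x" for x
  have d: "d \<in> P_h \<Omega> T l"
    unfolding d_def[abs_def] by (intro P_h_add P_h_cmul \<Omega> mesh a b)
  have "L2_inner \<Omega> d d = L2_inner \<Omega> a d + (- 1) * L2_inner \<Omega> b d"
    using L2_inner_add_left[OF P_h_L2[OF a] P_h_L2[OF P_h_cmul[OF \<Omega> mesh b]] P_h_L2[OF d], of "-1"]
    unfolding L2_inner_cmul_left d_def[abs_def] .
  then have "L2_inner \<Omega> d d = 0" using eq[OF d] by simp
  then have "AE x in lebesgue_on \<Omega>. d x \<bullet> d x = 0"
    using integral_nonneg_eq_0_iff_AE[OF L2_integrable_inner[OF P_h_L2[OF d] P_h_L2[OF d]]]
    by (simp add: L2_inner_def)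
  then have "AE x in lebesgue. x \<in> \<Omega> \<longrightarrow> d x = 0"
    using \<Omega> by (subst (asm) AE_restrict_space_iff) auto
  then obtain N where N: "N \<in> null_sets lebesgue" "{x. \<not> (x \<in> \<Omega> \<longrightarrow> d x = 0)} \<subseteq> N"
    by (auto elim!: AE_E3 simp: eventually_ae_filter)
  obtain r where r: "r \<in> polys (l - 1)" "\<And>x. x \<in> interior K \<Longrightarrow> a x = r x"
    by (rule piecewise_polysE[OF conjunct1[OF a[unfolded P_h_iff[OF \<Omega> mesh]]] K(1)]) (rule that)
  obtain s where s: "s \<in> polys (l - 1)" "\<And>x. x \<in> interior K \<Longrightarrow> b x = s x"
    by (rule piecewise_polysE[OF conjunct1[OF b[unfolded P_h_iff[OF \<Omega> mesh]]] K(1)]) (rule that)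
  define A where "A = interior K \<inter> {y. r y \<noteq> s y}"
  have "open A"
    unfolding A_def
    by (intro open_Int open_interior open_Collect_neq polys_continuous_on[OF r(1)] polys_continuous_on[OF s(1)])
  have "A \<inter> \<Omega> \<subseteq> N"
    using N(2) r(2) s(2) by (auto simp: A_def d_def)
  then have "negligible (A \<inter> \<Omega>)"
    using N(1) negligible_subset negligible_iff_null_sets by metis
  then have "A \<inter> \<Omega> = {}"
    using open_not_negligible[of "A \<inter> \<Omega>"] \<open>open A\<close> \<Omega>(1) by auto
  \<comment> \<open>An open set that misses \<Omega> misses its closure, and the closure is what
    contains the interior of \<open>K\<close>.\<close>
  then have "A \<inter> closure \<Omega> = {}" by (simp add: open_Int_closure_eq_empty \<open>open A\<close>)
  then have "A = {}" using mesh_simplex(4)[OF mesh K(1)] by (auto simp: A_def)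
  then have "b y = r y" if "y \<in> interior K" for y using that s(2) by (auto simp: A_def)
  then show ?thesis
    using restr_piecewise_polys[OF mesh K r] restr_piecewise_polys[OF mesh K r(1), of b] by simp
qed

section \<open>Divergences of the discrete fields\<close>

lemma divg_in_P_h:
  fixes u :: "real^'d \<Rightarrow> real^'d"
  assumes \<Omega>: "open \<Omega>" "bounded \<Omega>" and mesh: "mesh_of \<Omega> T"
    and u: "u \<in> Hdiv \<Omega>" "zero_normal_trace \<Omega> u"
    and loc: "\<And>K. K \<in> T \<Longrightarrow> \<exists>r. C1_polys_div (l - 1) r \<and> (\<forall>x\<in>interior K. u x = r x)"
  shows "divg u \<in> P_h \<Omega> T l"
proof -
  have loc': "\<exists>D. (\<forall>j. \<forall>x\<in>interior K. GDERIV (\<lambda>y. u y $ j) x :> D j x) \<and>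
      (\<forall>j. continuous_on UNIV (D j)) \<and> (\<lambda>x. \<Sum>j\<in>UNIV. D j x $ j) \<in> polys (l - 1)" if K: "K \<in> T" for K
  proof -
    obtain r where r: "C1_polys_div (l - 1) r" "\<And>x. x \<in> interior K \<Longrightarrow> r x = u x"
      using loc[OF K] by auto
    obtain D where D: "\<And>j x. GDERIV (\<lambda>y. r y $ j) x :> D j x" "\<forall>j. continuous_on UNIV (D j)"
      "(\<lambda>x. \<Sum>j\<in>UNIV. D j x $ j) \<in> polys (l - 1)"
      using r(1) unfolding C1_polys_div_def by blast
    \<comment> \<open>Derivatives are local, so agreement with the polynomial field on the open
      interior is enough.\<close>
    have "GDERIV (\<lambda>y. u y $ j) x :> D j x" if "x \<in> interior K" for j x
      using D(1)[of j x] unfolding gderiv_def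
      by (rule has_derivative_transform_within_open[OF _ open_interior that]) (simp add: r(2))
    with D(2,3) show ?thesis by blast
  qed
  have pw: "divg u \<in> piecewise_polys T (l - 1)"
    unfolding piecewise_polys_def
  proof (intro CollectI ballI)
    fix K assume "K \<in> T"
    from loc'[OF this] obtain D where D: "\<And>j x. x \<in> interior K \<Longrightarrow> GDERIV (\<lambda>y. u y $ j) x :> D j x"
      "(\<lambda>x. \<Sum>j\<in>UNIV. D j x $ j) \<in> polys (l - 1)" by blast
    from D(2) show "\<exists>r\<in>polys (l - 1). \<forall>x\<in>interior K. divg u x = r x"
      by (rule bexI[rotated]) (simp add: divg_GDERIV[OF D(1)])
  qed
  have "(LINT x|lebesgue_on \<Omega>. divg u x) = 0"
  proof (rule integral_divg_eq_0[OF lmeasurable_open[OF \<Omega>(2,1)] open_mesh_interior[OF \<Omega>(1)] _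
        negligible_skeleton[OF mesh] u])
    show "mesh_interior \<Omega> T \<subseteq> \<Omega>" by (simp add: mesh_interior_def)
    \<comment> \<open>Each simplex brings its own gradients. The rows of the Jacobian are one global
      name for all of them, so nothing has to be glued.\<close>
    show "GDERIV (\<lambda>y. u y $ j) x :> jacobian u (at x) $ j" if x: "x \<in> mesh_interior \<Omega> T" for j x
    proof -
      obtain K where K: "K \<in> T" "x \<in> interior K" using x by (auto simp: mesh_interior_def)
      from loc'[OF K(1)] obtain D where D: "\<And>j x. x \<in> interior K \<Longrightarrow> GDERIV (\<lambda>y. u y $ j) x :> D j x"
        by blast
      show ?thesis using D[OF K(2), of j] by (simp add: jacobian_GDERIV[OF D[OF K(2)]])
    qed
    show "continuous_on (mesh_interior \<Omega> T) (\<lambda>x. jacobian u (at x) $ j)" for j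
    proof (rule continuous_on_subset)
      show "continuous_on (\<Union>K\<in>T. interior K) (\<lambda>x. jacobian u (at x) $ j)"
      proof (rule continuous_on_open_UN)
        fix K assume "K \<in> T"
        from loc'[OF this] obtain D where D: "\<And>j x. x \<in> interior K \<Longrightarrow> GDERIV (\<lambda>y. u y $ j) x :> D j x"
          "\<And>j. continuous_on UNIV (D j)" by blast
        have "continuous_on (interior K) (D j)" using D(2) by (rule continuous_on_subset) simp
        then show "continuous_on (interior K) (\<lambda>x. jacobian u (at x) $ j)"
          by (rule continuous_on_eq) (simp add: jacobian_GDERIV[OF D(1)])
      qed simp
    qed (simp add: mesh_interior_def)
    show "divg u \<in> L2_on \<Omega>" by (rule piecewise_polys_L2[OF \<Omega> mesh pw])
  qed
  with pw show ?thesis by (simp add: P_h_iff[OF \<Omega> mesh])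
qed

lemma divg_U_h:
  assumes "open \<Omega>" "bounded \<Omega>" "mesh_of \<Omega> T" "u \<in> U_h \<Omega> T fam l"
  shows "divg u \<in> P_h \<Omega> T l"
proof (rule divg_in_P_h[OF assms(1-3)])
  show "\<exists>r. C1_polys_div (l - 1) r \<and> (\<forall>x\<in>interior K. u x = r x)" if "K \<in> T" for K
    using assms(4) that C1_polys_div_local_U unfolding U_h_def by blast
qed (use assms(4) in \<open>auto simp: U_h_def\<close>)

lemma divg_V_h:
  assumes "open \<Omega>" "bounded \<Omega>" "mesh_of \<Omega> T" "v \<in> V_h \<Omega> T l"
  shows "divg v \<in> P_h \<Omega> T l"
proof (rule divg_in_P_h[OF assms(1-3)])
  show "\<exists>r. C1_polys_div (l - 1) r \<and> (\<forall>x\<in>interior K. v x = r x)" if "K \<in> T" for K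
    using assms(4) that C1_polys_div_RT unfolding V_h_def by blast
qed (use assms(4) in \<open>auto simp: V_h_def\<close>)

section \<open>The mass balance\<close>

theorem proposition8:
  fixes \<Omega> :: "(real^'d) set"
    and T :: "(real^'d) set set"
    and fam :: displacement_family
    and l n :: nat
    and \<sigma> \<eta> lam \<tau> :: real
    and R \<alpha>p \<alpha> :: "nat \<Rightarrow> real"
    and \<beta> \<alpha>\<alpha> :: "nat \<Rightarrow> nat \<Rightarrow> real"
    and f :: "real^'d \<Rightarrow> real^'d"
    and g :: "nat \<Rightarrow> real^'d \<Rightarrow> real"
    and u :: "real^'d \<Rightarrow> real^'d"
    and v :: "nat \<Rightarrow> real^'d \<Rightarrow> real^'d"
    and p :: "nat \<Rightarrow> real^'d \<Rightarrow> real"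
  assumes dim: "CARD('d) = 2 \<or> CARD('d) = 3"
    and domain: "polyhedral_lipschitz_domain \<Omega>"
    and mesh: "mesh_of \<Omega> T" "shape_regular \<sigma> T"
    and l: "l \<ge> 1"
    and n: "n \<ge> 1"
    and lam: "lam > 0"
    and R: "\<And>i. i \<in> {1..n} \<Longrightarrow> inverse (R i) > 0"
    and \<alpha>p: "\<And>i. i \<in> {1..n} \<Longrightarrow> \<alpha>p i \<ge> 0"
    and \<tau>: "\<tau> > 0"
    and \<alpha>: "\<And>i. i \<in> {1..n} \<Longrightarrow> \<alpha> i > 0"
    and \<beta>: "\<And>i j. i \<in> {1..n} \<Longrightarrow> j \<in> {1..n} \<Longrightarrow> i \<noteq> j \<Longrightarrow> \<beta> i j = \<beta> j i \<and> \<beta> i j \<ge> 0"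
    and \<beta>_diag: "\<And>i. i \<in> {1..n} \<Longrightarrow> \<beta> i i = (\<Sum>j\<in>{1..n} - {i}. \<beta> i j)"
    and \<alpha>\<alpha>: "\<And>i j. i \<in> {1..n} \<Longrightarrow> j \<in> {1..n} \<Longrightarrow> \<alpha>\<alpha> i j = \<tau> * \<beta> i j / (\<alpha> i * \<alpha> j)"
    and f: "f \<in> L2_on \<Omega>"
    and g: "\<And>i. i \<in> {1..n} \<Longrightarrow> g i \<in> L2_on \<Omega>"
    and spaces: "u \<in> U_h \<Omega> T fam l" "v \<in> {1..n} \<rightarrow> V_h \<Omega> T l" "p \<in> {1..n} \<rightarrow> P_h \<Omega> T l"
    and solution: "\<And>w z q. w \<in> U_h \<Omega> T fam l \<Longrightarrow> z \<in> {1..n} \<rightarrow> V_h \<Omega> T l \<Longrightarrow>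
        q \<in> {1..n} \<rightarrow> P_h \<Omega> T l \<Longrightarrow>
        a_h T \<eta> u w + lam * L2_inner \<Omega> (divg u) (divg w) - (\<Sum>i=1..n. L2_inner \<Omega> (p i) (divg w))
          = L2_inner \<Omega> f w \<and>
        (\<forall>i\<in>{1..n}. L2_inner \<Omega> (\<lambda>x. inverse (R i) *\<^sub>R v i x) (z i) - L2_inner \<Omega> (p i) (divg (z i)) = 0) \<and>
        (\<forall>i\<in>{1..n}. - L2_inner \<Omega> (divg u) (q i) - L2_inner \<Omega> (divg (v i)) (q i)
             - (\<alpha>p i + \<alpha>\<alpha> i i) * L2_inner \<Omega> (p i) (q i)
             + (\<Sum>j\<in>{1..n} - {i}. \<alpha>\<alpha> i j * L2_inner \<Omega> (p j) (q i))
           = L2_inner \<Omega> (g i) (q i))"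
  shows "\<forall>i\<in>{1..n}.
     (\<forall>K\<in>T. \<forall>x\<in>K.
        - restr K (divg u) x - restr K (divg (v i)) x - (\<alpha>p i + \<alpha>\<alpha> i i) * restr K (p i) x
          + (\<Sum>j\<in>{1..n} - {i}. \<alpha>\<alpha> i j * restr K (p j) x)
        = restr K (L2_projection \<Omega> (P_h \<Omega> T l) (g i)) x) \<and>
     ((AE x in lebesgue_on \<Omega>. g i x = 0) \<longrightarrow>
      (\<forall>K\<in>T. \<forall>x\<in>K.
        - restr K (divg u) x - restr K (divg (v i)) x - (\<alpha>p i + \<alpha>\<alpha> i i) * restr K (p i) x
          + (\<Sum>j\<in>{1..n} - {i}. \<alpha>\<alpha> i j * restr K (p j) x) = 0))"
proof (intro ballI)
  fix i assume i: "i \<in> {1..n}"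
  have \<Omega>: "open \<Omega>" "bounded \<Omega>"
    using domain by (simp_all add: polyhedral_lipschitz_domain_def lipschitz_domain_def)
  note mesh' = mesh(1)
  define c where "c = \<alpha>p i + \<alpha>\<alpha> i i"
  define J where "J = {1..n} - {i}"
  \<comment> \<open>Naming -1 lets the residual be built from sums and multiples only, the
    operations under which \<open>P_h\<close>, \<open>restr\<close> and the moments are known to
    behave well.\<close>
  define m :: real where "m = - 1"
  define \<rho> where "\<rho> x = m * divg u x + (m * divg (v i) x
      + ((m * c) * p i x + (\<Sum>j\<in>J. \<alpha>\<alpha> i j * p j x)))" for x
  have du: "divg u \<in> P_h \<Omega> T l" using divg_U_h[OF \<Omega> mesh' spaces(1)] .
  have dv: "divg (v i) \<in> P_h \<Omega> T l" using divg_V_h[OF \<Omega> mesh' funcset_mem[OF spaces(2) i]] .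
  have pi: "p i \<in> P_h \<Omega> T l" using funcset_mem[OF spaces(3) i] .
  have pj: "p j \<in> P_h \<Omega> T l" if "j \<in> J" for j using funcset_mem[OF spaces(3), of j] that by (simp add: J_def)
  note cl = P_h_add[OF \<Omega> mesh'] P_h_cmul[OF \<Omega> mesh'] P_h_sum[OF \<Omega> mesh']
  have \<rho>: "\<rho> \<in> P_h \<Omega> T l"
    unfolding \<rho>_def[abs_def] by (intro cl du dv pi pj)
  have L2: "q \<in> L2_on \<Omega>" if "q \<in> P_h \<Omega> T l" for q using that by (rule P_h_L2)
  have moments: "L2_inner \<Omega> \<rho> s = L2_inner \<Omega> (g i) s" if s: "s \<in> P_h \<Omega> T l" for s
  proof -
    have "L2_inner \<Omega> \<rho> s = m * L2_inner \<Omega> (divg u) s + (m * L2_inner \<Omega> (divg (v i)) s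
        + ((m * c) * L2_inner \<Omega> (p i) s + (\<Sum>j\<in>J. \<alpha>\<alpha> i j * L2_inner \<Omega> (p j) s)))"
      unfolding \<rho>_def[abs_def]
      by (simp add: L2_inner_add_left L2_inner_sum_left L2_inner_cmul_left L2 cl du dv pi pj s)
    also have "\<dots> = - L2_inner \<Omega> (divg u) s - L2_inner \<Omega> (divg (v i)) s
        - c * L2_inner \<Omega> (p i) s + (\<Sum>j\<in>J. \<alpha>\<alpha> i j * L2_inner \<Omega> (p j) s)"
      by (simp add: m_def)
    also have "\<dots> = L2_inner \<Omega> (g i) s"
    proof -
      \<comment> \<open>One test function serves in all components, and u and v themselves fill the
        other two places; the i-th equation is then read off.\<close>
      have "(\<lambda>_. s) \<in> {1..n} \<rightarrow> P_h \<Omega> T l" using s by simp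
      from bspec[OF conjunct2[OF conjunct2[OF solution[OF spaces(1,2) this]]] i]
      show ?thesis unfolding c_def J_def .
    qed
    finally show ?thesis .
  qed
  have pw: "q \<in> piecewise_polys T (l - 1)" if "q \<in> P_h \<Omega> T l" for q
    using that by (simp add: P_h_iff[OF \<Omega> mesh'])
  have restr_\<rho>: "- restr K (divg u) x - restr K (divg (v i)) x - c * restr K (p i) x
      + (\<Sum>j\<in>J. \<alpha>\<alpha> i j * restr K (p j) x) = restr K \<rho> x" if K: "K \<in> T" "x \<in> K" for K x
  proof -
    note r = restr_add[OF mesh' K pw pw] restr_cmul[OF mesh' K pw] restr_sum[OF mesh' K pw]
    have "restr K \<rho> x = m * restr K (divg u) x + (m * restr K (divg (v i)) x
        + ((m * c) * restr K (p i) x + (\<Sum>j\<in>J. \<alpha>\<alpha> i j * restr K (p j) x)))"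
      unfolding \<rho>_def[abs_def]
      by (simp add: r cl du dv pi pj)
    then show ?thesis by (simp add: m_def)
  qed
  \<comment> \<open>The residual witnesses that the choice in \<open>L2_projection\<close> is made
    from a nonempty set.\<close>
  have proj: "L2_projection \<Omega> (P_h \<Omega> T l) (g i) \<in> P_h \<Omega> T l \<and>
      (\<forall>s\<in>P_h \<Omega> T l. L2_inner \<Omega> (L2_projection \<Omega> (P_h \<Omega> T l) (g i)) s = L2_inner \<Omega> (g i) s)"
    unfolding L2_projection_def by (rule someI[of _ \<rho>]) (use \<rho> moments in blast)
  have "restr K \<rho> x = restr K (L2_projection \<Omega> (P_h \<Omega> T l) (g i)) x" if "K \<in> T" "x \<in> K" for K x
    by (rule restr_eq_if_moments_eq[OF \<Omega> mesh' that \<rho> conjunct1[OF proj]])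
       (simp add: moments proj)
  moreover have "restr K \<rho> x = 0" if g0: "AE x in lebesgue_on \<Omega>. g i x = 0" and K: "K \<in> T" "x \<in> K" for K x
  proof -
    have g0': "L2_inner \<Omega> (g i) s = 0" for s
    proof -
      have "AE x in lebesgue_on \<Omega>. g i x \<bullet> s x = 0" using g0 by (rule eventually_mono) simp
      then show ?thesis unfolding L2_inner_def by (rule integral_eq_zero_AE)
    qed
    \<comment> \<open>The same uniqueness argument applies with the zero function in place of the
      projection.\<close>
    have "L2_inner \<Omega> \<rho> s = L2_inner \<Omega> (\<lambda>x. 0) s" if "s \<in> P_h \<Omega> T l" for s
      unfolding moments[OF that] g0' by (simp add: L2_inner_def)
    then have "restr K \<rho> x = restr K (\<lambda>x. 0) x"
      by (rule restr_eq_if_moments_eq[OF \<Omega> mesh' K \<rho> P_h_zero])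
    then show ?thesis by (simp add: restr_zero[OF mesh' K])
  qed
  ultimately show "(\<forall>K\<in>T. \<forall>x\<in>K.
        - restr K (divg u) x - restr K (divg (v i)) x - (\<alpha>p i + \<alpha>\<alpha> i i) * restr K (p i) x
          + (\<Sum>j\<in>{1..n} - {i}. \<alpha>\<alpha> i j * restr K (p j) x)
        = restr K (L2_projection \<Omega> (P_h \<Omega> T l) (g i)) x) \<and>
     ((AE x in lebesgue_on \<Omega>. g i x = 0) \<longrightarrow>
      (\<forall>K\<in>T. \<forall>x\<in>K.
        - restr K (divg u) x - restr K (divg (v i)) x - (\<alpha>p i + \<alpha>\<alpha> i i) * restr K (p i) x
          + (\<Sum>j\<in>{1..n} - {i}. \<alpha>\<alpha> i j * restr K (p j) x) = 0))"
    using restr_\<rho> unfolding c_def J_def by simp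
qed

end
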